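(* Let $n$ be a positive integer, let $p_0,p_1,\ldots,p_n$ be polynomials such that for some $l\in\{0,1,\ldots,n\}$ we have $\deg p_l>\deg p_k$ for every $k\in\{0,1,\ldots,n\}\setminus\{l\}$, and let $f$ be a non-trivial (i.e. not identically zero) meromorphic solution on $\mathbb{C}$ of the Wilson interpolation equation $$p_n(x)y(x^{+(n)})+p_{n-1}(x)y(x^{+(n-1)})+\cdots+p_1(x)y(x^+)+p_0(x)y(x)=0.$$ Then $f$ has order $\sigma\ge\frac12$.
   Context: Fix a branch $\sqrt{\cdot}$ of the square root with the imaginary axis (in the plane of $z=\sqrt x$) as branch cut: for $x\notin(-\infty,0]$ the values $\sqrt x$ lie in one fixed open half-plane bounded by the imaginary axis, and $\sqrt{-t^2}=it$ for $t\ge0$. Put $x^+:=(\sqrt x+\frac i2)^2$, $x^{+(0)}:=x$ and $x^{+(m)}:=(x^{+(m-1)})^+$ for $m\ge1$. The order of a meromorphic function $f$ is $\limsup_{r\to\infty}\frac{\ln^+T(r,f)}{\ln r}\in[0,+\infty]$, with $T$ the Nevanlinna characteristic. *)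

theory Defs
  imports "HOL-Complex_Analysis.Complex_Analysis" "HOL-Computational_Algebra.Polynomial"
begin

text \<open>
  The two admissible branches take values off the cut in the right or in the left
  half-plane, respectively; on the cut both take values in the closed upper imaginary axis.
\<close>

definition wilson_sqrt :: "(complex \<Rightarrow> complex) \<Rightarrow> bool" where
  "wilson_sqrt s \<longleftrightarrow>
     (\<forall>x. (s x)\<^sup>2 = x) \<and>
     ((\<forall>x. x \<notin> \<real>\<^sub>\<le>\<^sub>0 \<longrightarrow> Re (s x) > 0) \<or> (\<forall>x. x \<notin> \<real>\<^sub>\<le>\<^sub>0 \<longrightarrow> Re (s x) < 0)) \<and>
     (\<forall>t::real. t \<ge> 0 \<longrightarrow> s (- ((of_real t)\<^sup>2)) = \<i> * of_real t)"

definition wilson_plus :: "(complex \<Rightarrow> complex) \<Rightarrow> complex \<Rightarrow> complex" where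
  "wilson_plus s x = (s x + \<i> / 2)\<^sup>2"

definition wilson_shift :: "(complex \<Rightarrow> complex) \<Rightarrow> nat \<Rightarrow> complex \<Rightarrow> complex" where
  "wilson_shift s m x = (wilson_plus s ^^ m) x"

text \<open>
  The equation is an identity between meromorphic functions, so it is required at every
  point where all the terms \<open>f (wilson_shift s k x)\<close> are finite. (At a pole the HOL value of
  \<open>f\<close> is a dummy.) The exceptional points form a closed discrete set.
\<close>

definition wilson_solution ::
  "(complex \<Rightarrow> complex) \<Rightarrow> nat \<Rightarrow> (nat \<Rightarrow> complex poly) \<Rightarrow> (complex \<Rightarrow> complex) \<Rightarrow> bool" where
  "wilson_solution s n p f \<longleftrightarrow>
     (\<forall>x. (\<forall>k\<le>n. \<not> is_pole f (wilson_shift s k x)) \<longrightarrow>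
          (\<Sum>k\<le>n. poly (p k) x * f (wilson_shift s k x)) = 0)"

text \<open>The degree with the convention that the zero polynomial has degree \<open>-\<infinity>\<close>.\<close>

definition edegree :: "complex poly \<Rightarrow> ereal" where
  "edegree q = (if q = 0 then -\<infinity> else ereal (real (degree q)))"

definition ln_plus :: "real \<Rightarrow> real" where
  "ln_plus x = max 0 (ln x)"

definition pole_count :: "(complex \<Rightarrow> complex) \<Rightarrow> real \<Rightarrow> nat" where
  "pole_count f r = (\<Sum>z\<in>{z. norm z \<le> r \<and> is_pole f z}. nat (- zorder f z))"

definition proximity_fun :: "(complex \<Rightarrow> complex) \<Rightarrow> real \<Rightarrow> real" where
  "proximity_fun f r =
     1 / (2 * pi) * integral {0..2 * pi} (\<lambda>\<theta>. ln_plus (norm (f (of_real r * cis \<theta>))))"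

definition counting_fun :: "(complex \<Rightarrow> complex) \<Rightarrow> real \<Rightarrow> real" where
  "counting_fun f r =
     integral {0..r} (\<lambda>t. (real (pole_count f t) - real (pole_count f 0)) / t)
     + real (pole_count f 0) * ln r"

definition nevanlinna_char :: "(complex \<Rightarrow> complex) \<Rightarrow> real \<Rightarrow> real" where
  "nevanlinna_char f r = proximity_fun f r + counting_fun f r"

definition nevanlinna_order :: "(complex \<Rightarrow> complex) \<Rightarrow> ereal" where
  "nevanlinna_order f = Limsup at_top (\<lambda>r. ereal (ln_plus (nevanlinna_char f r) / ln r))"

end

theory Submission
  imports Defs "HOL-Real_Asymp.Real_Asymp"
begin

text \<open>
  With \<open>x = z\<^sup>2\<close> the shifts become \<open>x\<^bsup>+(k)\<^esup> = (z + k \<i>/2)\<^sup>2\<close>. Suppose the order is below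
  \<open>1/2\<close>, so that \<open>T(r, f) \<le> r\<^sup>\<beta>\<close> with \<open>\<beta> < 1/2\<close> for large \<open>r\<close>. On a disc of radius \<open>R\<close> write
  \<open>f\<close> as \<open>e\<^sup>q\<close> times a finite product of Blaschke factors. Evaluating at the origin gives Jensen's
  formula, hence \<open>O(R\<^sup>\<beta>)\<close> (up to logarithms) for the number of zeros and poles and for the mean of
  \<open>\<bar>ln \<bar>f\<bar>\<bar> = \<bar>Re q\<bar>\<close> on the circle; the latter bounds \<open>q'\<close> on the half-size disc by \<open>O(R\<^bsup>\<beta>-1\<^esup>)\<close>.
  For real \<open>z\<close> of size about \<open>\<surd>R\<close> the shifts move \<open>x\<close> by \<open>O(\<surd>R)\<close> only, and since there are
  \<open>o(\<surd>R / ln R)\<close> zeros and poles, averaging yields a \<open>z\<close> from which they are far enough to make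
  all quotients \<open>f(x\<^bsup>+(k)\<^esup>) / f(x\<^bsup>+(l)\<^esup>)\<close> bounded by \<open>e\<close>. As such \<open>z\<close> are arbitrarily large, this contradicts
  the dominance of \<open>p\<^sub>l\<close>.
\<close>

subsection \<open>Blaschke factorization\<close>

text \<open>For |a| < R the zero is at \<open>a\<close>, and the pole, present only for
  \<open>a\<close> nonzero, is at the mirror image of \<open>a\<close> in the circle |x| =
  R.\<close>

definition blaschke :: "real \<Rightarrow> complex \<Rightarrow> complex \<Rightarrow> complex" where
  "blaschke R a x = of_real R * (x - a) / (of_real (R\<^sup>2) - cnj a * x)"

lemma blaschke_denom_nonzero:
  assumes "norm a < R" "norm x \<le> R"
  shows "of_real (R\<^sup>2) - cnj a * x \<noteq> 0"
proof
  assume "of_real (R\<^sup>2) - cnj a * x = 0"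
  hence "norm (cnj a * x) = R\<^sup>2" by (metis eq_iff_diff_eq_0 norm_of_real abs_power2)
  hence "norm a * norm x = R * R" by (simp add: norm_mult power2_eq_square)
  moreover have "R > 0" using assms(1) norm_ge_zero[of a] by linarith
  have "norm a * norm x \<le> norm a * R" using assms by (intro mult_left_mono) auto
  moreover have "norm a * R < R * R" using assms(1) \<open>R > 0\<close> by (rule mult_strict_right_mono)
  ultimately show False using \<open>norm a * norm x = R * R\<close> by linarith
qed

text \<open>On the circle R^2 = x * cnj x, so the denominator is x times the conjugate of
  \<open>x - a\<close>.\<close>

lemma norm_blaschke_circle:
  assumes "norm a < R" "norm x = R"
  shows "norm (blaschke R a x) = 1"
proof -
  have R: "R > 0" using assms(1) norm_ge_zero[of a] by linarith
  have "x * cnj x = of_real (R\<^sup>2)" using assms(2) complex_norm_square[of x] by simp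
  hence "of_real (R\<^sup>2) - cnj a * x = x * cnj (x - a)" by (simp add: algebra_simps)
  hence "norm (of_real (R\<^sup>2) - cnj a * x) = R * norm (x - a)"
    using assms(2) by (simp only: norm_mult complex_mod_cnj)
  moreover have "x \<noteq> a" using assms by auto
  ultimately show ?thesis using R by (simp add: blaschke_def norm_divide norm_mult)
qed

lemma blaschke_nonzero:
  assumes "norm a < R" "norm x \<le> R" "x \<noteq> a"
  shows "blaschke R a x \<noteq> 0"
  using blaschke_denom_nonzero[OF assms(1,2)] assms norm_ge_zero[of a] by (auto simp: blaschke_def)

lemma blaschke_0: "R > 0 \<Longrightarrow> blaschke R 0 x = x / of_real R"
  by (simp add: blaschke_def power2_eq_square)

lemma norm_blaschke_at_0: "R > 0 \<Longrightarrow> norm (blaschke R a 0) = norm a / R"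
  by (simp add: blaschke_def norm_mult norm_divide power2_eq_square)

lemma blaschke_holomorphic:
  assumes "\<And>x. x \<in> A \<Longrightarrow> of_real (R\<^sup>2) - cnj a * x \<noteq> 0"
  shows "blaschke R a holomorphic_on A"
  unfolding blaschke_def using assms by (intro holomorphic_intros) auto

lemma zorder_blaschke:
  assumes "R > 0" "norm a < R" "of_real (R\<^sup>2) - cnj a * x \<noteq> 0"
  shows "zorder (blaschke R a) x = (if x = a then 1 else 0)"
proof -
  let ?U = "{y. of_real (R\<^sup>2) - cnj a * y \<noteq> (0::complex)}"
  have op: "open ?U" by (intro open_Collect_neq continuous_intros)
  have hol: "(\<lambda>y. of_real R / (of_real (R\<^sup>2) - cnj a * y)) holomorphic_on ?U"
    by (intro holomorphic_intros) auto
  show ?thesis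
  proof (cases "x = a")
    case True
    have "zorder (blaschke R a) x = 1"
      by (rule zorder_eqI[OF op _ hol]) (use assms True in \<open>auto simp: blaschke_def\<close>)
    then show ?thesis using True by simp
  next
    case False
    have "blaschke R a holomorphic_on ?U" by (rule blaschke_holomorphic) auto
    moreover have "x \<in> ?U" using assms by auto
    ultimately have "blaschke R a analytic_on {x}"
      using op analytic_at by blast
    moreover have "blaschke R a x \<noteq> 0" using assms False by (simp add: blaschke_def)
    ultimately show ?thesis using False by (simp add: zorder_eq_0I)
  qed
qed

section \<open>Zeros, poles and orders of a nonzero meromorphic function\<close>

locale nonzero_meromorphic =
  fixes f :: "complex \<Rightarrow> complex"
  assumes mero: "f nicely_meromorphic_on UNIV" and nz: "\<exists>x. f x \<noteq> 0"
begin

text \<open>A nicely meromorphic function takes the value 0 at its poles, so this set collects both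
  the zeros and the poles in the open disc. Likewise \<open>f x \<noteq> 0\<close> excludes
  both.\<close>

definition zeros :: "real \<Rightarrow> complex set" where
  "zeros R = {a. norm a < R \<and> f a = 0}"

lemma meromorphic: "f meromorphic_on A"
  using mero meromorphic_on_subset unfolding nicely_meromorphic_on_def by blast

lemma cosparse_nonzero: "eventually (\<lambda>z. f z \<noteq> 0) (cosparse UNIV)"
  using nicely_meromorphic_imp_constant_or_avoid[OF mero, of 0] nz by auto

lemma eventually_nonzero: "eventually (\<lambda>z. f z \<noteq> 0) (at x)"
  using cosparse_nonzero by (auto simp: eventually_cosparse_open_eq)

lemma frequently_nonzero: "frequently (\<lambda>z. f z \<noteq> 0) (at x)"
  using eventually_nonzero by (simp add: eventually_frequently)

lemma finite_zeros_cball: "finite {a. norm a \<le> R \<and> f a = 0}"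
proof -
  have "{a. f a = 0} sparse_in UNIV"
    using cosparse_nonzero by (simp add: eventually_cosparse)
  hence "{a. f a = 0} sparse_in cball 0 R" using sparse_in_subset by blast
  hence "finite (cball 0 R \<inter> {a. f a = 0})" by (rule sparse_in_compact_finite) auto
  also have "cball 0 R \<inter> {a. f a = 0} = {a. norm a \<le> R \<and> f a = 0}" by auto
  finally show ?thesis .
qed

lemma finite_zeros: "finite (zeros R)"
  by (rule finite_subset[OF _ finite_zeros_cball[of R]]) (auto simp: zeros_def)

lemma pole_imp_zero: "is_pole f a \<Longrightarrow> f a = 0"
  using is_pole_zero_at_nicely_mero[OF mero] by simp

lemma analytic_at_nonzero: "f a \<noteq> 0 \<Longrightarrow> f analytic_on {a}"
  using nicely_meromorphic_on_imp_analytic_at[OF mero] pole_imp_zero by blast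

lemma zorder_nonzero: "f a \<noteq> 0 \<Longrightarrow> zorder f a = 0"
  using analytic_at_nonzero zorder_eq_0I by blast

lemma is_pole_iff: "is_pole f a \<longleftrightarrow> zorder f a < 0"
  using zorder_neg_imp_is_pole[OF meromorphic eventually_nonzero]
    isolated_pole_imp_neg_zorder meromorphic[of "{a}"] meromorphic_at_iff by blast

text \<open>The zeros and poles in a disc have only finitely many moduli, so some circle in the
  annulus avoids them all.\<close>

lemma generic_radius:
  obtains R where "R > r" "R < r + 1" "\<And>x. norm x = R \<Longrightarrow> f x \<noteq> 0"
proof -
  have "finite (norm ` {a. norm a \<le> r + 1 \<and> f a = 0})" using finite_zeros_cball by blast
  hence "infinite ({r<..<r+1} - norm ` {a. norm a \<le> r + 1 \<and> f a = 0})"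
    by (intro Diff_infinite_finite) (auto simp: infinite_Ioo)
  then obtain R where "R \<in> {r<..<r+1} - norm ` {a. norm a \<le> r + 1 \<and> f a = 0}"
    by (metis ex_in_conv finite.emptyI)
  then show ?thesis by (intro that[of R]) (auto simp: image_iff)
qed

text \<open>Dividing \<open>f\<close> by the Blaschke factors, raised to the orders of
  \<open>f\<close>, cancels all zeros and poles in the disc. The quotient extends to a nonvanishing
  holomorphic function on a slightly larger disc and so has a logarithm \<open>q\<close> there. The
  larger disc makes \<open>q\<close> continuous up to the circle.\<close>

lemma blaschke_factorization:
  assumes R: "R > 0" and circ: "\<And>x. norm x = R \<Longrightarrow> f x \<noteq> 0"
  obtains q R' where "R' > R" "q holomorphic_on ball 0 R'"
    "\<And>x. norm x \<le> R \<Longrightarrow> f x \<noteq> 0 \<Longrightarrow>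
       f x = exp (q x) * (\<Prod>a\<in>zeros R. blaschke R a x powi zorder f a)"
proof -
  define Z where "Z = zeros R"
  have finZ: "finite Z" and Zn: "\<And>a. a \<in> Z \<Longrightarrow> norm a < R"
    using finite_zeros by (auto simp: Z_def zeros_def)
  \<comment> \<open>The obstacles to enlarging the disc: zeros and poles of \<open>f\<close> outside
    it, and the poles of the Blaschke factors. They are finitely many and of modulus above
    \<open>R\<close>; \<open>R'\<close> stays below them.\<close>
  define bad where "bad = {a. norm a \<le> R + 1 \<and> f a = 0} - Z \<union> (\<lambda>a. of_real (R\<^sup>2) / cnj a) ` (Z - {0})"
  have finb: "finite bad" unfolding bad_def using finZ finite_zeros_cball by blast
  have badn: "norm b > R" if b: "b \<in> bad" for b
  proof (cases "b \<in> {a. norm a \<le> R + 1 \<and> f a = 0} - Z")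
    case True
    hence "norm b \<noteq> R" using circ[of b] by auto
    moreover have "\<not> norm b < R" using True by (auto simp: Z_def zeros_def)
    ultimately show ?thesis by linarith
  next
    case False
    then obtain a where a: "a \<in> Z" "a \<noteq> 0" "b = of_real (R\<^sup>2) / cnj a"
      using b unfolding bad_def by blast
    hence nb: "norm b = R\<^sup>2 / norm a" by (simp add: norm_divide norm_power R)
    have "R * norm a < R * R" using Zn[OF a(1)] R by simp
    thus ?thesis unfolding nb using a(2) by (simp add: pos_less_divide_eq power2_eq_square)
  qed
  define R' where "R' = Min (insert (R + 1) (norm ` bad))"
  have R': "R' > R" "R' \<le> R + 1" "\<And>b. b \<in> bad \<Longrightarrow> norm b \<ge> R'"
    using finb badn by (auto simp: R'_def)
  have den: "of_real (R\<^sup>2) - cnj a * x \<noteq> 0" if "a \<in> Z" "norm x < R'" for a x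
  proof
    assume *: "of_real (R\<^sup>2) - cnj a * x = 0"
    hence "a \<noteq> 0" using R by auto
    hence "x = of_real (R\<^sup>2) / cnj a" using * by (simp add: field_simps)
    hence "x \<in> bad" using that(1) \<open>a \<noteq> 0\<close> unfolding bad_def by blast
    thus False using R'(3)[of x] that(2) by linarith
  qed
  have fz: "a \<in> Z" if "norm a < R'" "f a = 0" for a
  proof (rule ccontr)
    assume "a \<notin> Z"
    hence "a \<in> bad" using that R'(2) by (simp add: bad_def)
    thus False using R'(3)[of a] that(1) by linarith
  qed
  define h where "h = (\<lambda>x. f x * (\<Prod>a\<in>Z. blaschke R a x powi (- zorder f a)))"
  have Ban: "blaschke R a analytic_on {x}" if "a \<in> Z" "norm x < R'" for a x
  proof -
    have "blaschke R a holomorphic_on ball 0 R'"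
      by (rule blaschke_holomorphic) (use den that(1) in auto)
    thus ?thesis using analytic_at[of "blaschke R a" x] that(2) by (metis dist_0_norm mem_ball open_ball)
  qed
  have Bnz: "eventually (\<lambda>y. blaschke R a y powi k \<noteq> 0) (at x)" if "a \<in> Z" "norm x < R'" for a x k
  proof -
    have "eventually (\<lambda>y. y \<in> ball 0 R') (at x)"
      using that by (intro eventually_at_in_open') auto
    moreover have "eventually (\<lambda>y. y \<noteq> a) (at x)"
      by (rule eventually_neq_at_within)
    ultimately show ?thesis
      by eventually_elim (use den that R in \<open>auto simp: blaschke_def\<close>)
  qed
  \<comment> \<open>At a point of \<open>Z\<close> exactly one Blaschke factor has nonzero order,
    namely 1, and its exponent cancels the order of \<open>f\<close>. Elsewhere all orders are
    0.\<close>
  have zh: "zorder h x = 0" and hm: "h meromorphic_on {x}" and ev: "eventually (\<lambda>y. h y \<noteq> 0) (at x)"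
    if x: "norm x < R'" for x
  proof -
    have Bm: "blaschke R a meromorphic_on {x}" if "a \<in> Z" for a
      using Ban[OF that x] analytic_on_imp_meromorphic_on by blast
    show hm: "h meromorphic_on {x}"
      unfolding h_def by (intro meromorphic_intros meromorphic Bm)
    have evP: "eventually (\<lambda>y. (\<Prod>a\<in>Z. blaschke R a y powi (- zorder f a)) \<noteq> 0) (at x)"
    proof -
      have "eventually (\<lambda>y. \<forall>a\<in>Z. blaschke R a y powi (- zorder f a) \<noteq> 0) (at x)"
        using finZ Bnz x by (intro eventually_ball_finite) auto
      thus ?thesis by eventually_elim (use finZ in auto)
    qed
    show ev: "eventually (\<lambda>y. h y \<noteq> 0) (at x)"
      using evP eventually_nonzero[of x] by eventually_elim (auto simp: h_def)
    have "zorder h x = zorder f x + zorder (\<lambda>y. \<Prod>a\<in>Z. blaschke R a y powi (- zorder f a)) x"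
      unfolding h_def using evP frequently_nonzero[of x]
      by (intro zorder_mult meromorphic meromorphic_intros Bm) (auto simp: eventually_frequently)
    also have "zorder (\<lambda>y. \<Prod>a\<in>Z. blaschke R a y powi (- zorder f a)) x
        = (\<Sum>a\<in>Z. zorder (\<lambda>y. blaschke R a y powi (- zorder f a)) x)"
      by (intro zorder_prod evP meromorphic_intros Bm)
    also have "\<dots> = (\<Sum>a\<in>Z. if a = x then - zorder f x else 0)"
    proof (intro sum.cong refl)
      fix a assume a: "a \<in> Z"
      have "zorder (\<lambda>y. blaschke R a y powi (- zorder f a)) x = - zorder f a * zorder (blaschke R a) x"
        using Bnz[OF a x, of 1] by (intro zorder_power_int Bm a) (auto simp: eventually_frequently)
      also have "\<dots> = (if a = x then - zorder f x else 0)"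
        using zorder_blaschke[OF R Zn[OF a] den[OF a x]] by auto
      finally show "zorder (\<lambda>y. blaschke R a y powi (- zorder f a)) x = (if a = x then - zorder f x else 0)" .
    qed
    also have "\<dots> = (if x \<in> Z then - zorder f x else 0)" using finZ by simp
    finally show "zorder h x = 0" using fz[OF x] zorder_nonzero[of x] by auto
  qed
  \<comment> \<open>On \<open>Z\<close> the product \<open>h\<close> evaluates to 0 because
    \<open>f\<close> does; the true value there is the limit, which is nonzero since the order is
    0.\<close>
  define g where "g = remove_sings h"
  have g: "g analytic_on {x}" "g x \<noteq> 0" if x: "norm x < R'" for x
  proof -
    have iso: "isolated_singularity_at h x" and ness: "not_essential h x"
      using hm[OF x] meromorphic_at_iff by auto
    have np: "\<not> is_pole h x"
      using isolated_pole_imp_neg_zorder[OF iso] zh[OF x] by auto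
    have niz: "\<not> isolated_zero h x"
      using zorder_isolated_zero_pos'[OF _ iso] zh[OF x] by auto
    obtain c where c: "h \<midarrow>x\<rightarrow> c" using ness np by (auto simp: not_essential_def)
    show "g analytic_on {x}" unfolding g_def by (rule remove_sings_analytic_at[OF iso c])
    have "c \<noteq> 0" using niz c ev[OF x] by (auto simp: isolated_zero_def)
    thus "g x \<noteq> 0" using remove_sings_eqI[OF c] by (simp add: g_def)
  qed
  have "g holomorphic_on ball 0 R'"
    using g(1) by (intro analytic_imp_holomorphic) (subst analytic_on_analytic_at, simp)
  moreover have "contractible (ball (0::complex) R')" by (simp add: convex_imp_contractible)
  ultimately obtain q where q: "q holomorphic_on ball 0 R'" "\<And>x. x \<in> ball 0 R' \<Longrightarrow> g x = exp (q x)"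
    using g(2) by (rule_tac contractible_imp_holomorphic_log[of g "ball 0 R'"]) auto
  show ?thesis
  proof (rule that[OF R'(1) q(1)])
    fix x assume x: "norm x \<le> R" "f x \<noteq> 0"
    hence xR': "norm x < R'" using R' by simp
    have xZ: "x \<notin> Z" using x by (auto simp: Z_def zeros_def)
    have Bx: "blaschke R a x \<noteq> 0" if "a \<in> Z" for a
      using blaschke_nonzero[OF Zn[OF that] x(1)] xZ that by auto
    \<comment> \<open>Where \<open>f\<close> has neither zero nor pole, \<open>h\<close> is already
      analytic and removing singularities does not change its value.\<close>
    have "h analytic_on {x}"
      unfolding h_def using Ban xR' Bx analytic_at_nonzero[OF x(2)]
      by (intro analytic_intros) auto
    hence "h x = exp (q x)" using q(2)[of x] xR' by (simp add: g_def)
    hence "f x * (\<Prod>a\<in>Z. blaschke R a x powi (- zorder f a)) = exp (q x)" by (simp add: h_def)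
    moreover have "(\<Prod>a\<in>Z. blaschke R a x powi (- zorder f a)) * (\<Prod>a\<in>Z. blaschke R a x powi zorder f a) = 1"
      using Bx by (simp add: prod.distrib[symmetric] power_int_minus)
    ultimately have "f x = exp (q x) * (\<Prod>a\<in>Z. blaschke R a x powi zorder f a)"
      by (metis mult.assoc mult.right_neutral)
    thus "f x = exp (q x) * (\<Prod>a\<in>zeros R. blaschke R a x powi zorder f a)" by (simp only: Z_def)
  qed
qed

end

subsection \<open>Bounding a holomorphic function by the mean of its real part\<close>

text \<open>Cauchy's formula at the centre, where du / u = i dt.\<close>

lemma mean_value_circle:
  assumes "R > 0" "continuous_on (cball 0 R) g" "g holomorphic_on ball 0 R"
  shows "((\<lambda>t. g (of_real R * cis t)) has_integral of_real (2 * pi) * g 0) {0..2*pi}"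
proof -
  have "((\<lambda>u. g u / (u - 0)) has_contour_integral (2 * of_real pi * \<i> * g 0)) (part_circlepath 0 R 0 (2*pi))"
    using Cauchy_integral_circlepath[OF assms(2,3), of 0] assms(1) by (simp add: circlepath_def)
  hence "((\<lambda>t. g (0 + of_real R * cis t) / (0 + of_real R * cis t - 0) * of_real R * \<i> * cis t)
      has_integral 2 * of_real pi * \<i> * g 0) {0..2*pi}"
    by (subst (asm) has_contour_integral_part_circlepath_iff) auto
  hence "((\<lambda>t. - \<i> * (g (0 + of_real R * cis t) / (0 + of_real R * cis t - 0) * of_real R * \<i> * cis t))
      has_integral - \<i> * (2 * of_real pi * \<i> * g 0)) {0..2*pi}"
    by (rule has_integral_mult_right)
  moreover have "- \<i> * (g (0 + of_real R * cis t) / (0 + of_real R * cis t - 0) * of_real R * \<i> * cis t)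
      = g (of_real R * cis t)" for t
    using assms(1) by (simp add: field_simps)
  ultimately show ?thesis by (simp add: field_simps)
qed

lemma Cauchy_derivative_circle:
  assumes "R > 0" "continuous_on (cball 0 R) q" "q holomorphic_on ball 0 R" "norm x < R"
  shows "((\<lambda>t. q (of_real R * cis t) * (of_real R * cis t / (of_real R * cis t - x)\<^sup>2))
           has_integral of_real (2 * pi) * deriv q x) {0..2*pi}"
proof -
  define I where "I = contour_integral (circlepath 0 R) (\<lambda>u. q u / (u-x)\<^sup>2)"
  have x: "x \<in> ball 0 R" using assms by simp
  have "deriv q x = 1 / (2 * of_real pi * \<i>) * I"
    using Cauchy_derivative_integral_circlepath(2)[OF assms(2,3) x] DERIV_imp_deriv I_def by blast
  hence "\<i> * (2 * of_real pi * deriv q x) = I" by (simp add: field_simps)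
  hence "- \<i> * I = - \<i> * (\<i> * (2 * of_real pi * deriv q x))" by simp
  hence I: "2 * of_real pi * deriv q x = - \<i> * I" by (simp add: mult.assoc[symmetric])
  have "((\<lambda>u. q u / (u-x)\<^sup>2) has_contour_integral I) (part_circlepath 0 R 0 (2*pi))"
    using Cauchy_derivative_integral_circlepath(1)[OF assms(2,3) x] has_contour_integral_integral
    unfolding I_def circlepath_def by blast
  hence "((\<lambda>t. q (0 + of_real R * cis t) / (0 + of_real R * cis t - x)\<^sup>2 * of_real R * \<i> * cis t)
      has_integral I) {0..2*pi}"
    by (subst (asm) has_contour_integral_part_circlepath_iff) auto
  hence "((\<lambda>t. - \<i> * (q (0 + of_real R * cis t) / (0 + of_real R * cis t - x)\<^sup>2 * of_real R * \<i> * cis t))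
      has_integral - \<i> * I) {0..2*pi}"
    by (rule has_integral_mult_right)
  moreover have "- \<i> * (q (0 + of_real R * cis t) / (0 + of_real R * cis t - x)\<^sup>2 * of_real R * \<i> * cis t)
      = q (of_real R * cis t) * (of_real R * cis t / (of_real R * cis t - x)\<^sup>2)" for t
    by (simp add: field_simps)
  ultimately show ?thesis using I by (simp add: field_simps)
qed

text \<open>
  On the circle the conjugate of the Cauchy kernel extends to a holomorphic function vanishing
  at the centre, so in Cauchy's formula \<open>q\<close> may be replaced by twice its real part.
\<close>

lemma norm_deriv_le_mean_Re:
  assumes "R > 0" "continuous_on (cball 0 R) q" "q holomorphic_on ball 0 R" "norm x \<le> R / 2"
  shows "norm (deriv q x) \<le> 8 / R * (1 / (2 * pi) * integral {0..2*pi} (\<lambda>t. \<bar>Re (q (of_real R * cis t))\<bar>))"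
proof -
  define \<zeta> where "\<zeta> = (\<lambda>t. of_real R * cis t :: complex)"
  define K where "K = (\<lambda>t. \<zeta> t / (\<zeta> t - x)\<^sup>2)"
  have n\<zeta>: "norm (\<zeta> t) = R" for t using assms(1) by (simp add: \<zeta>_def norm_mult)
  have I1: "((\<lambda>t. q (\<zeta> t) * K t) has_integral of_real (2 * pi) * deriv q x) {0..2*pi}"
    using Cauchy_derivative_circle[OF assms(1-3), of x] assms(1,4) by (simp add: \<zeta>_def K_def)
  \<comment> \<open>Putting R^2 / z for cnj z in the conjugate kernel gives this holomorphic factor,
    whose denominator has no zero in the closed disc.\<close>
  define g where "g = (\<lambda>z. q z * (of_real (R\<^sup>2) * z / (of_real (R\<^sup>2) - cnj x * z)\<^sup>2))"
  have den: "of_real (R\<^sup>2) - cnj x * z \<noteq> 0" if "norm z \<le> R" for z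
    using blaschke_denom_nonzero[of x R z] assms that by auto
  have cg: "continuous_on (cball 0 R) g" and hg: "g holomorphic_on ball 0 R"
    unfolding g_def using assms(2,3) den by (auto intro!: continuous_intros holomorphic_intros)
  have gK: "g (\<zeta> t) = q (\<zeta> t) * cnj (K t)" for t
  proof -
    have c: "of_real (R\<^sup>2) = \<zeta> t * cnj (\<zeta> t)" using complex_norm_square[of "\<zeta> t"] n\<zeta>[of t] by simp
    have nz: "\<zeta> t \<noteq> 0" using n\<zeta>[of t] assms(1) by auto
    have "of_real (R\<^sup>2) - cnj x * \<zeta> t = \<zeta> t * cnj (\<zeta> t - x)" unfolding c by (simp add: algebra_simps)
    hence "of_real (R\<^sup>2) * \<zeta> t / (of_real (R\<^sup>2) - cnj x * \<zeta> t)\<^sup>2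
        = \<zeta> t * cnj (\<zeta> t) * \<zeta> t / (\<zeta> t * cnj (\<zeta> t - x))\<^sup>2" using c by simp
    also have "\<dots> = cnj (\<zeta> t) / (cnj (\<zeta> t - x))\<^sup>2"
      using nz by (simp add: power2_eq_square power_mult_distrib)
    finally show ?thesis by (simp only: g_def K_def complex_cnj_divide complex_cnj_power)
  qed
  have "((\<lambda>t. g (\<zeta> t)) has_integral of_real (2 * pi) * g 0) {0..2*pi}"
    unfolding \<zeta>_def by (rule mean_value_circle[OF assms(1) cg hg])
  hence "((\<lambda>t. q (\<zeta> t) * cnj (K t)) has_integral 0) {0..2*pi}"
    by (simp add: gK) (simp add: g_def)
  hence "((cnj \<circ> (\<lambda>t. q (\<zeta> t) * cnj (K t))) has_integral cnj 0) {0..2*pi}"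
    by (subst has_integral_cnj)
  hence "((\<lambda>t. cnj (q (\<zeta> t)) * K t) has_integral 0) {0..2*pi}" by (simp add: o_def)
  from has_integral_add[OF I1 this]
  have I: "((\<lambda>t. of_real (2 * Re (q (\<zeta> t))) * K t) has_integral of_real (2 * pi) * deriv q x) {0..2*pi}"
    by (simp only: complex_add_cnj distrib_right[symmetric] add_0_right)
  have cont\<zeta>: "continuous_on {0..2*pi} (\<lambda>t. q (\<zeta> t))"
    by (rule continuous_on_compose2[OF assms(2)])
      (use n\<zeta> in \<open>auto simp: \<zeta>_def intro!: continuous_intros\<close>)
  have int: "(\<lambda>t. 8 / R * \<bar>Re (q (\<zeta> t))\<bar>) integrable_on {0..2*pi}"
    by (intro integrable_continuous_real continuous_intros cont\<zeta>)
  have "norm (integral {0..2*pi} (\<lambda>t. of_real (2 * Re (q (\<zeta> t))) * K t))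
      \<le> integral {0..2*pi} (\<lambda>t. 8 / R * \<bar>Re (q (\<zeta> t))\<bar>)"
  proof (rule integral_norm_bound_integral[OF _ int])
    show "(\<lambda>t. of_real (2 * Re (q (\<zeta> t))) * K t) integrable_on {0..2*pi}" using I by blast
    fix t
    \<comment> \<open>The kernel is at most R / (R/2)^2 = 4/R; the factor 2 in front of the real
      part makes it 8/R.\<close>
    have n2: "norm (\<zeta> t - x) \<ge> R / 2" using n\<zeta>[of t] assms(4) norm_triangle_ineq2[of "\<zeta> t" x] by linarith
    hence "norm (\<zeta> t - x) ^ 2 \<ge> (R/2)^2" using assms(1) by (intro power_mono) auto
    hence "norm (K t) \<le> R / (R/2)^2"
      unfolding K_def norm_divide norm_power n\<zeta> using assms(1) n2
      by (intro divide_left_mono mult_pos_pos zero_less_power) auto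
    also have "\<dots> = 4 / R" using assms(1) by (simp add: power2_eq_square field_simps)
    finally have "norm (K t) \<le> 4 / R" .
    hence "2 * \<bar>Re (q (\<zeta> t))\<bar> * norm (K t) \<le> 2 * \<bar>Re (q (\<zeta> t))\<bar> * (4 / R)" by (intro mult_left_mono) auto
    thus "norm (of_real (2 * Re (q (\<zeta> t))) * K t) \<le> 8 / R * \<bar>Re (q (\<zeta> t))\<bar>"
      by (simp add: norm_mult abs_mult algebra_simps)
  qed
  moreover have "integral {0..2*pi} (\<lambda>t. of_real (2 * Re (q (\<zeta> t))) * K t) = of_real (2 * pi) * deriv q x"
    using I by (rule integral_unique)
  ultimately have "2 * pi * norm (deriv q x) \<le> 8 / R * integral {0..2*pi} (\<lambda>t. \<bar>Re (q (\<zeta> t))\<bar>)"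
    by (simp add: norm_mult)
  hence "1 / (2 * pi) * (2 * pi * norm (deriv q x))
      \<le> 1 / (2 * pi) * (8 / R * integral {0..2*pi} (\<lambda>t. \<bar>Re (q (\<zeta> t))\<bar>))"
    by (rule mult_left_mono) simp
  thus ?thesis by (simp add: \<zeta>_def mult_ac)
qed

text \<open>The derivative bound is uniform on the half-size disc, which is convex, so it is a
  Lipschitz constant there.\<close>

lemma norm_diff_le_mean_Re:
  assumes "R > 0" "R' > R" "q holomorphic_on ball 0 R'" "norm x \<le> R / 2" "norm y \<le> R / 2"
  shows "norm (q x - q y)
    \<le> 8 / R * (1 / (2 * pi) * integral {0..2*pi} (\<lambda>t. \<bar>Re (q (of_real R * cis t))\<bar>)) * norm (x - y)"
proof (rule field_differentiable_bound[OF convex_cball[of 0 "R/2"]])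
  have c: "continuous_on (cball 0 R) q" and h: "q holomorphic_on ball 0 R"
    using assms(1,2) holomorphic_on_imp_continuous_on[OF assms(3)]
    by (auto intro: continuous_on_subset holomorphic_on_subset[OF assms(3)])
  fix z :: complex assume z: "z \<in> cball 0 (R/2)"
  have "z \<in> ball 0 R'" using z assms by auto
  thus "(q has_field_derivative deriv q z) (at z within cball 0 (R/2))"
    using assms(3) holomorphic_derivI has_field_derivative_at_within by (metis open_ball)
  show "norm (deriv q z) \<le> 8 / R * (1 / (2 * pi) * integral {0..2*pi} (\<lambda>t. \<bar>Re (q (of_real R * cis t))\<bar>))"
    using norm_deriv_le_mean_Re[OF assms(1) c h, of z] z by simp
qed (use assms in auto)

subsection \<open>Jensen's formula and the Nevanlinna characteristic\<close>

context nonzero_meromorphic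
begin

abbreviation multip :: "complex \<Rightarrow> real" where
  "multip a \<equiv> \<bar>real_of_int (zorder f a)\<bar>"

text \<open>In Nevanlinna's notation this is m(R, f) + m(R, 1/f).\<close>

definition mean_abs_ln :: "real \<Rightarrow> real" where
  "mean_abs_ln R = 1 / (2 * pi) * integral {0..2*pi} (\<lambda>t. \<bar>ln (norm (f (of_real R * cis t)))\<bar>)"

text \<open>The Blaschke factors have modulus one on the circle, so only exp q contributes.\<close>

lemma factorization_on_circle:
  assumes R: "R > 0" and circ: "\<And>x. norm x = R \<Longrightarrow> f x \<noteq> 0"
    and fq: "\<And>x. norm x \<le> R \<Longrightarrow> f x \<noteq> 0 \<Longrightarrow>
       f x = exp (q x) * (\<Prod>a\<in>zeros R. blaschke R a x powi zorder f a)"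
    and x: "norm x = R"
  shows "ln (norm (f x)) = Re (q x)"
proof -
  have "norm (f x) = norm (exp (q x)) * (\<Prod>a\<in>zeros R. norm (blaschke R a x) powi zorder f a)"
    using fq[of x] x circ by (simp add: norm_mult prod_norm[symmetric] norm_power_int)
  also have "(\<Prod>a\<in>zeros R. norm (blaschke R a x) powi zorder f a) = 1"
    using x by (intro prod.neutral) (auto simp: zeros_def norm_blaschke_circle)
  finally show ?thesis by simp
qed

text \<open>The factorization is evaluated at 0, with the leading Laurent coefficient
  \<open>zor_poly f 0 0\<close> in place of \<open>f 0\<close> so that the origin may be a zero or a
  pole. As Re (q 0) is the mean of ln |f| on the circle, this is Jensen's formula.\<close>

lemma jensen_at_0:
  assumes R: "R > 0" and circ: "\<And>x. norm x = R \<Longrightarrow> f x \<noteq> 0"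
    and R': "R' > R" and q: "q holomorphic_on ball 0 R'"
    and fq: "\<And>x. norm x \<le> R \<Longrightarrow> f x \<noteq> 0 \<Longrightarrow>
       f x = exp (q x) * (\<Prod>a\<in>zeros R. blaschke R a x powi zorder f a)"
  shows "Re (q 0) = ln (norm (zor_poly f 0 0)) + zorder f 0 * ln R
           + (\<Sum>a\<in>zeros R - {0}. zorder f a * ln (R / norm a))"
proof -
  let ?m = "zorder f 0"
  \<comment> \<open>The factorization divided by x^m: the Blaschke factor at the origin is x / R and
    leaves R^(-m). Since \<open>G\<close> is continuous at 0, it has the value
    \<open>zor_poly f 0 0\<close> there.\<close>
  define G where "G = (\<lambda>x. exp (q x) * of_real R powi (- ?m) * (\<Prod>a\<in>zeros R - {0}. blaschke R a x powi zorder f a))"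
  have iso: "isolated_singularity_at f 0" "not_essential f 0"
    using meromorphic[of "{0}"] meromorphic_at_iff by auto
  from zorder_exist[OF iso frequently_nonzero] obtain r where r: "r > 0" "zor_poly f 0 0 \<noteq> 0"
    "zor_poly f 0 holomorphic_on cball 0 r"
    "\<And>w. w \<in> cball 0 r - {0} \<Longrightarrow> f w = zor_poly f 0 w * (w - 0) powi ?m \<and> zor_poly f 0 w \<noteq> 0"
    by blast
  have "isCont (zor_poly f 0) 0"
    using r(1,3) by (metis ball_subset_cball centre_in_ball continuous_on_interior
        holomorphic_on_imp_continuous_on interior_cball)
  hence l1: "zor_poly f 0 \<midarrow>0\<rightarrow> zor_poly f 0 0" by (simp add: isCont_def)
  have "q \<midarrow>0\<rightarrow> q 0"
    using holomorphic_on_imp_continuous_on[OF q] R R' by (simp add: continuous_on_eq_continuous_at isCont_def)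
  hence l2: "G \<midarrow>0\<rightarrow> G 0" unfolding G_def blaschke_def using R
    by (intro tendsto_intros) (auto simp: zeros_def)
  have "eventually (\<lambda>x. x \<in> ball 0 (min r R) - {0}) (at 0)"
    using r(1) R by (intro eventually_at_in_open) auto
  hence "eventually (\<lambda>x. zor_poly f 0 x = G x) (at 0)"
  proof eventually_elim
    case (elim x)
    hence x: "x \<noteq> 0" "norm x \<le> R" "x \<in> cball 0 r - {0}" by auto
    hence fx: "f x \<noteq> 0" using r(4) by auto
    have e: "f x = zor_poly f 0 x * x powi ?m" using r(4)[OF x(3)] by simp
    have "(\<Prod>a\<in>zeros R. blaschke R a x powi zorder f a)
        = (x / of_real R) powi ?m * (\<Prod>a\<in>zeros R - {0}. blaschke R a x powi zorder f a)"
    proof (cases "0 \<in> zeros R")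
      case True
      then show ?thesis using finite_zeros R by (simp add: prod.remove[of _ 0] blaschke_0)
    next
      case False
      hence "f 0 \<noteq> 0" using R by (simp add: zeros_def)
      then show ?thesis using False by (simp add: zorder_nonzero)
    qed
    hence "zor_poly f 0 x * x powi ?m = G x * x powi ?m"
      using fq[OF x(2) fx] e by (simp add: G_def power_int_divide_distrib power_int_minus field_simps)
    thus ?case using x by simp
  qed
  hence "zor_poly f 0 \<midarrow>0\<rightarrow> G 0" using l2 tendsto_cong by metis
  hence "zor_poly f 0 0 = G 0" using l1 LIM_unique by blast
  hence "norm (zor_poly f 0 0) = exp (Re (q 0)) * R powi (- ?m) * (\<Prod>a\<in>zeros R - {0}. (norm a / R) powi zorder f a)"
    using R by (simp add: G_def norm_mult prod_norm[symmetric] norm_power_int norm_blaschke_at_0)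
  hence "ln (norm (zor_poly f 0 0)) = ln (exp (Re (q 0))) + ln (R powi (- ?m))
      + ln (\<Prod>a\<in>zeros R - {0}. (norm a / R) powi zorder f a)"
  proof -
    have "(\<Prod>a\<in>zeros R - {0}. (norm a / R) powi zorder f a) > 0"
      using R by (intro prod_pos) auto
    moreover have "R powi (- ?m) > 0" using R by simp
    ultimately show ?thesis using \<open>norm (zor_poly f 0 0) = _\<close> by (simp only: ln_mult_pos mult_pos_pos exp_gt_zero)
  qed
  also have "ln (R powi (- ?m)) = - ?m * ln R"
    using R by (simp add: powr_real_of_int'[symmetric] ln_powr)
  also have "ln (\<Prod>a\<in>zeros R - {0}. (norm a / R) powi zorder f a)
      = (\<Sum>a\<in>zeros R - {0}. ln ((norm a / R) powi zorder f a))"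
    using R finite_zeros by (intro ln_prod) auto
  also have "\<dots> = (\<Sum>a\<in>zeros R - {0}. - (zorder f a * ln (R / norm a)))"
  proof (intro sum.cong refl)
    fix a assume a: "a \<in> zeros R - {0}"
    have "ln ((norm a / R) powi zorder f a) = zorder f a * ln (norm a / R)"
      using a R by (simp add: powr_real_of_int'[symmetric] ln_powr)
    thus "ln ((norm a / R) powi zorder f a) = - (zorder f a * ln (R / norm a))"
      using a R by (simp add: ln_div algebra_simps)
  qed
  finally show ?thesis by (simp add: sum_negf)
qed

text \<open>The index set no longer depends on \<open>t\<close>, so the counting integral can be
  evaluated term by term. No pole is lost, because the circle of radius \<open>R\<close> carries
  none.\<close>

lemma pole_count_eq:
  assumes circ: "\<And>x. norm x = R \<Longrightarrow> f x \<noteq> 0" and t: "t \<le> R"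
  shows "pole_count f t = (\<Sum>a\<in>zeros R. if norm a \<le> t then nat (- zorder f a) else 0)"
proof -
  have sub: "{z. norm z \<le> t \<and> is_pole f z} \<subseteq> zeros R"
  proof
    fix z assume z: "z \<in> {z. norm z \<le> t \<and> is_pole f z}"
    hence "f z = 0" "norm z \<le> R" using pole_imp_zero t by auto
    moreover have "norm z \<noteq> R" using circ[of z] calculation by auto
    ultimately show "z \<in> zeros R" by (simp add: zeros_def)
  qed
  have "pole_count f t = (\<Sum>a\<in>{z. norm z \<le> t \<and> is_pole f z}. if norm a \<le> t then nat (- zorder f a) else 0)"
    unfolding pole_count_def by (intro sum.cong) auto
  also have "\<dots> = (\<Sum>a\<in>zeros R. if norm a \<le> t then nat (- zorder f a) else 0)"
    using finite_zeros sub by (intro sum.mono_neutral_left) (auto simp: is_pole_iff)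
  finally show ?thesis .
qed

lemma pole_count_0: "pole_count f 0 = nat (- zorder f 0)"
proof (cases "is_pole f 0")
  case True
  hence "{z. norm z \<le> 0 \<and> is_pole f z} = {0}" by auto
  then show ?thesis by (simp add: pole_count_def)
next
  case False
  hence *: "{z. norm z \<le> 0 \<and> is_pole f z} = {}" by auto
  show ?thesis using False unfolding pole_count_def * by (simp add: is_pole_iff)
qed

text \<open>A pole \<open>a\<close> other than 0 contributes its multiplicity divided by t on
  [|a|, R], and the integral of 1/t there is ln (R / |a|).\<close>

lemma counting_fun_eq:
  assumes R: "R > 0" and circ: "\<And>x. norm x = R \<Longrightarrow> f x \<noteq> 0"
  shows "counting_fun f R = (\<Sum>a\<in>zeros R - {0}. real (nat (- zorder f a)) * ln (R / norm a))
           + real (nat (- zorder f 0)) * ln R"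
proof -
  define c where "c a = real (nat (- zorder f a))" for a
  have zR: "0 < norm a" "norm a \<le> R" if "a \<in> zeros R - {0}" for a using that by (auto simp: zeros_def)
  have eq: "(\<Sum>a\<in>zeros R - {0}. if t \<in> {norm a..R} then c a / t else 0)
      = (real (pole_count f t) - real (pole_count f 0)) / t" if t: "t \<in> {0..R}" for t
  proof -
    \<comment> \<open>If the origin is not in \<open>zeros R\<close>, its order is 0, so its term
      can be split off in either case.\<close>
    have c0: "c 0 = (if 0 \<in> zeros R then c 0 else 0)"
      using zorder_nonzero[of 0] R by (auto simp: zeros_def c_def)
    have "real (pole_count f t) = (\<Sum>a\<in>zeros R. if norm a \<le> t then c a else 0)"
      using t by (subst pole_count_eq[OF circ]) (auto simp: c_def of_nat_sum intro!: sum.cong)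
    also have "\<dots> = c 0 + (\<Sum>a\<in>zeros R - {0}. if norm a \<le> t then c a else 0)"
    proof (cases "0 \<in> zeros R")
      case True
      then show ?thesis using finite_zeros t by (simp add: sum.remove[of _ 0])
    next
      case False
      then show ?thesis using c0 by simp
    qed
    finally have "real (pole_count f t) - real (pole_count f 0)
        = (\<Sum>a\<in>zeros R - {0}. if norm a \<le> t then c a else 0)"
      by (simp add: pole_count_0 c_def)
    hence "(real (pole_count f t) - real (pole_count f 0)) / t
        = (\<Sum>a\<in>zeros R - {0}. (if norm a \<le> t then c a else 0) / t)"
      by (simp only: sum_divide_distrib)
    also have "\<dots> = (\<Sum>a\<in>zeros R - {0}. if t \<in> {norm a..R} then c a / t else 0)"
      using t by (intro sum.cong refl) auto
    finally show ?thesis by (rule sym)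
  qed
  have "((\<lambda>t. \<Sum>a\<in>zeros R - {0}. if t \<in> {norm a..R} then c a / t else 0) has_integral
      (\<Sum>a\<in>zeros R - {0}. c a * ln (R / norm a))) {0..R}"
  proof (intro has_integral_sum)
    fix a assume a: "a \<in> zeros R - {0}"
    note z = zR[OF a]
    have "((\<lambda>t. c a / t) has_integral (c a * ln R - c a * ln (norm a))) {norm a..R}"
    proof (rule fundamental_theorem_of_calculus[OF z(2)])
      fix t assume "t \<in> {norm a..R}"
      hence "norm a \<le> t" by simp
      hence "t > 0" using z(1) by linarith
      hence "((\<lambda>x. c a * ln x) has_real_derivative c a / t) (at t within {norm a..R})"
        by (auto intro!: derivative_eq_intros)
      thus "((\<lambda>x. c a * ln x) has_vector_derivative c a / t) (at t within {norm a..R})"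
        by (simp add: has_real_derivative_iff_has_vector_derivative)
    qed
    moreover have "c a * ln R - c a * ln (norm a) = c a * ln (R / norm a)"
      using z R by (simp add: ln_div algebra_simps)
    moreover have "{norm a..R} \<subseteq> {0..R}" by auto
    ultimately show "((\<lambda>t. if t \<in> {norm a..R} then c a / t else 0) has_integral c a * ln (R / norm a)) {0..R}"
      by (simp only: has_integral_restrict)
  qed (use finite_zeros in auto)
  hence "((\<lambda>t. (real (pole_count f t) - real (pole_count f 0)) / t) has_integral
      (\<Sum>a\<in>zeros R - {0}. c a * ln (R / norm a))) {0..R}"
    by (rule has_integral_eq[rotated]) (rule eq)
  thus ?thesis unfolding counting_fun_def by (simp add: integral_unique pole_count_0 c_def)
qed

text \<open>Jensen's formula, rearranged as in the first main theorem, shows that the two left-hand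
  sides together are at most \<open>B\<close>. Both are nonnegative, so each is at most
  \<open>B\<close>.\<close>

lemma nevanlinna_bounds:
  assumes R: "R \<ge> 1" and circ: "\<And>x. norm x = R \<Longrightarrow> f x \<noteq> 0"
  defines "B \<equiv> 2 * nevanlinna_char f R + \<bar>ln (norm (zor_poly f 0 0))\<bar> + multip 0 * ln R"
  shows "mean_abs_ln R \<le> B" "(\<Sum>a\<in>zeros R - {0}. multip a * ln (R / norm a)) \<le> B"
proof -
  have R0: "R > 0" using R by simp
  obtain q R' where q: "R' > R" "q holomorphic_on ball 0 R'"
    and fq: "\<And>x. norm x \<le> R \<Longrightarrow> f x \<noteq> 0 \<Longrightarrow>
       f x = exp (q x) * (\<Prod>a\<in>zeros R. blaschke R a x powi zorder f a)"
    using blaschke_factorization[OF R0 circ] by blast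
  define u where "u = (\<lambda>t. ln (norm (f (of_real R * cis t))))"
  have nR: "norm (of_real R * cis t) = R" for t using R by (simp add: norm_mult)
  have u: "u t = Re (q (of_real R * cis t))" for t
    unfolding u_def by (rule factorization_on_circle[OF R0 circ fq nR])
  have cq: "continuous_on (cball 0 R) q" and hq: "q holomorphic_on ball 0 R"
    using q(1) holomorphic_on_imp_continuous_on[OF q(2)]
    by (auto intro: continuous_on_subset holomorphic_on_subset[OF q(2)])
  have cu: "continuous_on {0..2*pi} u"
    unfolding u by (intro continuous_intros continuous_on_compose2[OF cq]) (use nR in auto)
  have "((\<lambda>t. Re (q (of_real R * cis t))) has_integral Re (of_real (2 * pi) * q 0)) {0..2*pi}"
    using has_integral_Re[OF mean_value_circle[OF R0 cq hq]] .
  hence mu: "1 / (2 * pi) * integral {0..2*pi} u = Re (q 0)"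
  proof -
    have "u = (\<lambda>t. Re (q (of_real R * cis t)))" using u by blast
    moreover have "Re (of_real (2 * pi) * q 0) = 2 * pi * Re (q 0)" by simp
    ultimately show ?thesis
      using integral_unique[OF \<open>((\<lambda>t. Re (q (of_real R * cis t))) has_integral _) _\<close>] by simp
  qed
  have prox: "proximity_fun f R = 1 / (2 * pi) * integral {0..2*pi} (\<lambda>t. max 0 (u t))"
    by (simp add: proximity_fun_def ln_plus_def u_def)
  \<comment> \<open>The identity |u| = 2 max 0 u - u brings in the proximity function and the mean
    of \<open>u\<close>, which is Re (q 0).\<close>
  have "integral {0..2*pi} (\<lambda>t. \<bar>u t\<bar>) = integral {0..2*pi} (\<lambda>t. 2 * max 0 (u t) - u t)"
    by (intro integral_cong) auto
  also have "\<dots> = 2 * integral {0..2*pi} (\<lambda>t. max 0 (u t)) - integral {0..2*pi} u"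
    by (subst integral_diff)
      (auto intro!: integrable_continuous_real continuous_intros cu)
  finally have "1 / (2 * pi) * integral {0..2*pi} (\<lambda>t. \<bar>u t\<bar>) = 2 * proximity_fun f R - Re (q 0)"
    unfolding prox mu[symmetric] by (simp add: diff_divide_distrib)
  hence mean: "mean_abs_ln R = 2 * proximity_fun f R - Re (q 0)"
    by (simp add: mean_abs_ln_def u_def)
  have "0 \<le> integral {0..2*pi} (\<lambda>t. \<bar>u t\<bar>)" by (intro integral_nonneg integrable_continuous_real continuous_intros cu) auto
  hence mean0: "mean_abs_ln R \<ge> 0" by (simp add: mean_abs_ln_def u_def)
  define Sa where "Sa = (\<Sum>a\<in>zeros R - {0}. multip a * ln (R / norm a))"
  define Sp where "Sp = (\<Sum>a\<in>zeros R - {0}. real (nat (- zorder f a)) * ln (R / norm a))"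
  \<comment> \<open>The signed order is the absolute order minus twice the pole
    multiplicity.\<close>
  have "(\<Sum>a\<in>zeros R - {0}. zorder f a * ln (R / norm a)) =
      (\<Sum>a\<in>zeros R - {0}. multip a * ln (R / norm a) - 2 * (real (nat (- zorder f a)) * ln (R / norm a)))"
  proof (intro sum.cong refl)
    fix a
    have "real_of_int (zorder f a) = multip a - 2 * real (nat (- zorder f a))" by linarith
    hence "zorder f a * ln (R / norm a) = (multip a - 2 * real (nat (- zorder f a))) * ln (R / norm a)"
      by (rule arg_cong[where f = "\<lambda>x. x * ln (R / norm a)"])
    thus "zorder f a * ln (R / norm a) = multip a * ln (R / norm a) - 2 * (real (nat (- zorder f a)) * ln (R / norm a))"
      by (simp only: left_diff_distrib mult.assoc)
  qed
  also have "\<dots> = Sa - 2 * Sp" by (simp add: Sa_def Sp_def sum_subtractf sum_distrib_left)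
  finally have qq: "Re (q 0) = ln (norm (zor_poly f 0 0)) + zorder f 0 * ln R + Sa - 2 * Sp"
    using jensen_at_0[OF R0 circ q fq] by simp
  have T: "nevanlinna_char f R = proximity_fun f R + Sp + real (nat (- zorder f 0)) * ln R"
    by (simp add: nevanlinna_char_def counting_fun_eq[OF R0 circ] Sp_def)
  have Sa0: "Sa \<ge> 0" unfolding Sa_def using R0
    by (intro sum_nonneg mult_nonneg_nonneg) (auto simp: zeros_def field_simps)
  have p0: "real (nat (- zorder f 0)) * ln R \<ge> 0" using R by simp
  have "- multip 0 * ln R \<le> zorder f 0 * ln R" using R by (intro mult_right_mono) auto
  hence m0: "- (multip 0 * ln R) \<le> zorder f 0 * ln R" by simp
  show "mean_abs_ln R \<le> B" using mean qq T Sa0 p0 m0 unfolding B_def by linarith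
  show "(\<Sum>a\<in>zeros R - {0}. multip a * ln (R / norm a)) \<le> B"
    using mean qq T mean0 p0 m0 unfolding B_def Sa_def[symmetric] by linarith
qed

text \<open>A nonzero point of modulus below r has R / |a| >= 3 > e, so its logarithmic weight is at
  least 1. The origin is absent from the weighted sum and is added as
  \<open>multip 0\<close>.\<close>

lemma sum_multip_le:
  assumes r: "r > 0" "3 * r \<le> R" and R: "R \<ge> 1" and circ: "\<And>x. norm x = R \<Longrightarrow> f x \<noteq> 0"
  shows "(\<Sum>a\<in>zeros r. multip a)
    \<le> 2 * nevanlinna_char f R + \<bar>ln (norm (zor_poly f 0 0))\<bar> + multip 0 * ln R + multip 0"
proof -
  have "(\<Sum>a\<in>zeros r. multip a) \<le> (\<Sum>a\<in>insert 0 (zeros r - {0}). multip a)"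
    using finite_zeros by (intro sum_mono2) auto
  also have "\<dots> = multip 0 + (\<Sum>a\<in>zeros r - {0}. multip a)"
    using finite_zeros by (subst sum.insert) auto
  also have "(\<Sum>a\<in>zeros r - {0}. multip a) \<le> (\<Sum>a\<in>zeros r - {0}. multip a * ln (R / norm a))"
  proof (intro sum_mono)
    fix a assume a: "a \<in> zeros r - {0}"
    have "3 * norm a \<le> R" using a r by (auto simp: zeros_def)
    hence "3 \<le> R / norm a" using a by (simp add: field_simps)
    hence "exp 1 \<le> R / norm a" using exp_le by linarith
    hence "1 \<le> ln (R / norm a)" using a R by (subst ln_ge_iff) auto
    thus "multip a \<le> multip a * ln (R / norm a)" using mult_left_mono[of 1 _ "multip a"] by simp
  qed
  also have "\<dots> \<le> (\<Sum>a\<in>zeros R - {0}. multip a * ln (R / norm a))"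
  proof (intro sum_mono2)
    show "zeros r - {0} \<subseteq> zeros R - {0}" using r by (auto simp: zeros_def)
    fix a assume "a \<in> zeros R - {0} - (zeros r - {0})"
    thus "0 \<le> multip a * ln (R / norm a)" using R
      by (intro mult_nonneg_nonneg) (auto simp: zeros_def field_simps)
  qed (use finite_zeros in auto)
  finally show ?thesis using nevanlinna_bounds(2)[OF R circ] by linarith
qed

end

subsection \<open>Quotients of values at nearby points\<close>

text \<open>The triangle inequality gives the factor 1 + d/e, and 1 + t <= exp t. The exponential
  form lets many factors be multiplied.\<close>

lemma norm_diff_ratio_le_exp:
  fixes u v c :: complex
  assumes "v \<noteq> c" "norm (u - v) \<le> d" "0 < e" "e \<le> norm (v - c)"
  shows "norm (u - c) \<le> norm (v - c) * exp (d / e)"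
proof -
  have d: "d \<ge> 0" using assms(2) norm_ge_zero[of "u - v"] by linarith
  have "norm (u - c) \<le> norm (v - c) + norm (u - v)"
    using norm_triangle_ineq[of "v - c" "u - v"] by simp
  also have "\<dots> \<le> norm (v - c) + norm (v - c) * (d / e)"
  proof -
    have "norm (u - v) \<le> e * (d / e)" using assms by simp
    also have "\<dots> \<le> norm (v - c) * (d / e)" using assms d by (intro mult_right_mono) auto
    finally show ?thesis by simp
  qed
  also have "\<dots> = norm (v - c) * (1 + d / e)" by (simp add: algebra_simps)
  also have "\<dots> \<le> norm (v - c) * exp (d / e)"
    by (intro mult_left_mono exp_ge_add_one_self) auto
  finally show ?thesis .
qed

text \<open>The factors w - c and w + c are compared separately, and |v - c|, |v + c| are bounded
  below by their real parts. The bound thus involves \<open>c\<close> only through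
  \<open>Re c\<close>, which leaves a one-dimensional avoidance problem.\<close>

lemma norm_square_diff_ratio_le_exp:
  fixes u v c :: complex
  assumes "norm (u - v) \<le> d" "Re v = r" "r \<noteq> Re c" "r \<noteq> - Re c"
  shows "norm (u\<^sup>2 - c\<^sup>2) \<le> norm (v\<^sup>2 - c\<^sup>2) * exp (d * (1 / \<bar>r - Re c\<bar> + 1 / \<bar>r + Re c\<bar>))"
proof -
  have 1: "norm (u - c) \<le> norm (v - c) * exp (d / \<bar>r - Re c\<bar>)"
    using assms abs_Re_le_cmod[of "v - c"] by (intro norm_diff_ratio_le_exp) auto
  have 2: "norm (u - (-c)) \<le> norm (v - (-c)) * exp (d / \<bar>r + Re c\<bar>)"
    using assms abs_Re_le_cmod[of "v + c"] by (intro norm_diff_ratio_le_exp) auto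
  have sq: "w\<^sup>2 - c\<^sup>2 = (w - c) * (w - (-c))" for w by (simp add: power2_eq_square algebra_simps)
  have "norm (u - c) * norm (u - (-c))
      \<le> (norm (v - c) * exp (d / \<bar>r - Re c\<bar>)) * (norm (v - (-c)) * exp (d / \<bar>r + Re c\<bar>))"
    by (intro mult_mono 1 2) auto
  also have "\<dots> = norm (v - c) * norm (v - (-c)) * exp (d * (1 / \<bar>r - Re c\<bar> + 1 / \<bar>r + Re c\<bar>))"
    by (simp add: exp_add[symmetric] ring_distribs)
  finally show ?thesis by (simp only: sq norm_mult)
qed

text \<open>The numerator is a difference of squares with c = csqrt a. On the half-size disc the
  denominator is at least R^2 / 2 in modulus and has Lipschitz constant |a| < R; this gives the term
  2 |u^2 - v^2| / R.\<close>

lemma norm_blaschke_ratio_le_exp: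
  fixes u v a :: complex
  assumes R: "R > 0" and a: "norm a < R" and x: "norm (u\<^sup>2) \<le> R / 2" and y: "norm (v\<^sup>2) \<le> R / 2"
    and d: "norm (u - v) \<le> d" and r: "Re v = r" "r \<noteq> Re (csqrt a)" "r \<noteq> - Re (csqrt a)"
  shows "norm (blaschke R a (u\<^sup>2)) \<le> norm (blaschke R a (v\<^sup>2)) *
    exp (2 * norm (u\<^sup>2 - v\<^sup>2) / R + d * (1 / \<bar>r - Re (csqrt a)\<bar> + 1 / \<bar>r + Re (csqrt a)\<bar>))"
proof -
  define D where "D = (\<lambda>x::complex. of_real (R\<^sup>2) - cnj a * x)"
  define e where "e = norm (u\<^sup>2 - v\<^sup>2)"
  have Dge: "norm (D z) \<ge> R\<^sup>2 / 2" if "norm z \<le> R / 2" for z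
  proof -
    have "norm (cnj a * z) \<le> R * (R / 2)" unfolding norm_mult complex_mod_cnj
      using a that by (intro mult_mono) (auto intro: order_trans[OF norm_ge_zero less_imp_le[OF a]])
    moreover have "norm (of_real (R\<^sup>2) :: complex) = R * R" using R by (simp only: norm_of_real abs_power2) (simp add: power2_eq_square)
    moreover have "norm (of_real (R\<^sup>2) :: complex) - norm (cnj a * z) \<le> norm (D z)"
      unfolding D_def by (rule norm_triangle_ineq2)
    ultimately show ?thesis by (simp add: power2_eq_square)
  qed
  have R2: "R\<^sup>2 / 2 > 0" using R by simp
  have Dpos: "norm (D (u\<^sup>2)) > 0" "norm (D (v\<^sup>2)) > 0"
    using Dge[OF x] Dge[OF y] R2 by linarith+
  have "norm (D (v\<^sup>2)) \<le> norm (D (u\<^sup>2)) * exp (2 * e / R)"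
  proof -
    have "norm (D (v\<^sup>2) - 0) \<le> norm (D (u\<^sup>2) - 0) * exp (R * e / (R\<^sup>2 / 2))"
    proof (rule norm_diff_ratio_le_exp)
      have "D (v\<^sup>2) - D (u\<^sup>2) = cnj a * (u\<^sup>2 - v\<^sup>2)" by (simp add: D_def algebra_simps)
      hence "norm (D (v\<^sup>2) - D (u\<^sup>2)) = norm a * e" by (simp add: norm_mult e_def)
      also have "\<dots> \<le> R * e" using a by (intro mult_right_mono) (auto simp: e_def)
      finally show "norm (D (v\<^sup>2) - D (u\<^sup>2)) \<le> R * e" .
    qed (use Dpos Dge[OF x] R2 in auto)
    thus ?thesis using R by (simp add: power2_eq_square mult.commute)
  qed
  hence D: "1 / norm (D (u\<^sup>2)) \<le> exp (2 * e / R) / norm (D (v\<^sup>2))"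
    using Dpos by (simp add: field_simps)
  have N: "norm (u\<^sup>2 - a) \<le> norm (v\<^sup>2 - a) * exp (d * (1 / \<bar>r - Re (csqrt a)\<bar> + 1 / \<bar>r + Re (csqrt a)\<bar>))"
    using norm_square_diff_ratio_le_exp[OF d r] by simp
  have bl: "norm (blaschke R a z) = R * (norm (z - a) * (1 / norm (D z)))" for z
    using R by (simp add: blaschke_def D_def norm_mult norm_divide)
  have "norm (u\<^sup>2 - a) * (1 / norm (D (u\<^sup>2))) \<le>
    (norm (v\<^sup>2 - a) * exp (d * (1 / \<bar>r - Re (csqrt a)\<bar> + 1 / \<bar>r + Re (csqrt a)\<bar>))) * (exp (2 * e / R) / norm (D (v\<^sup>2)))"
    by (intro mult_mono N D) auto
  also have "\<dots> = norm (v\<^sup>2 - a) * (1 / norm (D (v\<^sup>2))) *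
     exp (2 * e / R + d * (1 / \<bar>r - Re (csqrt a)\<bar> + 1 / \<bar>r + Re (csqrt a)\<bar>))"
    unfolding exp_add by simp
  finally have "R * (norm (u\<^sup>2 - a) * (1 / norm (D (u\<^sup>2)))) \<le> R * (norm (v\<^sup>2 - a) * (1 / norm (D (v\<^sup>2))) *
     exp (2 * e / R + d * (1 / \<bar>r - Re (csqrt a)\<bar> + 1 / \<bar>r + Re (csqrt a)\<bar>)))"
    using R by (intro mult_left_mono) auto
  thus ?thesis unfolding bl e_def by (simp only: mult.assoc)
qed

text \<open>A negative power reverses the inequality, hence the two-sided hypothesis.\<close>

lemma power_int_ratio_le_exp:
  fixes X Y E :: real and m :: int
  assumes "X > 0" "Y > 0" "X \<le> Y * exp E" "Y \<le> X * exp E"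
  shows "X powi m \<le> Y powi m * exp (\<bar>real_of_int m\<bar> * E)"
proof (cases "m \<ge> 0")
  case True
  have "X powi m = X ^ nat m" "Y powi m = Y ^ nat m" using True by (simp_all add: power_int_def)
  moreover have "X ^ nat m \<le> (Y * exp E) ^ nat m" using assms by (intro power_mono) auto
  moreover have "exp E ^ nat m = exp (\<bar>real_of_int m\<bar> * E)"
    using True by (simp add: exp_of_nat_mult[symmetric])
  ultimately show ?thesis by (simp add: power_mult_distrib)
next
  case False
  define k where "k = nat (- m)"
  have e: "X powi m = 1 / X ^ k" "Y powi m = 1 / Y ^ k"
    using False by (simp_all add: power_int_def k_def inverse_eq_divide power_one_over)
  have "Y ^ k \<le> (X * exp E) ^ k" using assms by (intro power_mono) auto
  moreover have "exp E ^ k = exp (\<bar>real_of_int m\<bar> * E)"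
    using False by (simp add: exp_of_nat_mult[symmetric] k_def)
  ultimately have "Y ^ k \<le> X ^ k * exp (\<bar>real_of_int m\<bar> * E)" by (simp add: power_mult_distrib)
  thus ?thesis unfolding e using assms by (simp add: field_simps)
qed

context nonzero_meromorphic
begin

text \<open>In the Blaschke factorization exp q is controlled by the Lipschitz bound for
  \<open>q\<close>, and each factor by its own ratio estimate. A zero or pole at w^2 = a would force
  w = csqrt a or w = - csqrt a, which \<open>avoid\<close> excludes.\<close>

lemma norm_ratio_le_exp:
  fixes u v :: complex
  assumes R: "R > 0" and circ: "\<And>x. norm x = R \<Longrightarrow> f x \<noteq> 0"
    and x: "norm (u\<^sup>2) \<le> R / 2" and y: "norm (v\<^sup>2) \<le> R / 2"
    and d: "norm (u - v) \<le> d" and r: "Re u = r" "Re v = r"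
    and avoid: "\<And>a. a \<in> zeros R \<Longrightarrow> r \<noteq> Re (csqrt a) \<and> r \<noteq> - Re (csqrt a)"
  shows "f (u\<^sup>2) \<noteq> 0" "f (v\<^sup>2) \<noteq> 0"
    "norm (f (u\<^sup>2)) \<le> norm (f (v\<^sup>2)) * exp (8 / R * mean_abs_ln R * norm (u\<^sup>2 - v\<^sup>2)
      + (\<Sum>a\<in>zeros R. multip a * (2 * norm (u\<^sup>2 - v\<^sup>2) / R
          + d * (1 / \<bar>r - Re (csqrt a)\<bar> + 1 / \<bar>r + Re (csqrt a)\<bar>))))"
proof -
  have nz: "f (w\<^sup>2) \<noteq> 0" if "norm (w\<^sup>2) \<le> R / 2" "Re w = r" for w
  proof
    assume "f (w\<^sup>2) = 0"
    hence z: "w\<^sup>2 \<in> zeros R" using that R by (simp add: zeros_def)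
    have "csqrt (w\<^sup>2) = w \<or> csqrt (w\<^sup>2) = - w"
      by (metis power2_csqrt power2_eq_iff)
    hence "Re (csqrt (w\<^sup>2)) = r \<or> Re (csqrt (w\<^sup>2)) = - r"
      using that(2) by (metis uminus_complex.sel(1))
    thus False using avoid[OF z] by linarith
  qed
  show fu: "f (u\<^sup>2) \<noteq> 0" and fv: "f (v\<^sup>2) \<noteq> 0" using nz x y r by auto
  obtain q R' where q: "R' > R" "q holomorphic_on ball 0 R'"
    and fq: "\<And>x. norm x \<le> R \<Longrightarrow> f x \<noteq> 0 \<Longrightarrow>
       f x = exp (q x) * (\<Prod>a\<in>zeros R. blaschke R a x powi zorder f a)"
    using blaschke_factorization[OF R circ] by blast
  define E where "E = (\<lambda>a. 2 * norm (u\<^sup>2 - v\<^sup>2) / R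
          + d * (1 / \<bar>r - Re (csqrt a)\<bar> + 1 / \<bar>r + Re (csqrt a)\<bar>))"
  have mean: "mean_abs_ln R = 1 / (2 * pi) * integral {0..2*pi} (\<lambda>t. \<bar>Re (q (of_real R * cis t))\<bar>)"
    using factorization_on_circle[OF R circ fq] R by (simp add: mean_abs_ln_def norm_mult)
  have qd: "norm (q (u\<^sup>2) - q (v\<^sup>2)) \<le> 8 / R * mean_abs_ln R * norm (u\<^sup>2 - v\<^sup>2)"
    using norm_diff_le_mean_Re[OF R q x y] by (simp only: mean)
  have form: "norm (f (w\<^sup>2)) = exp (Re (q (w\<^sup>2))) * (\<Prod>a\<in>zeros R. norm (blaschke R a (w\<^sup>2)) powi zorder f a)"
    if "norm (w\<^sup>2) \<le> R / 2" "Re w = r" for w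
  proof -
    have "norm (w\<^sup>2) \<le> R" using that R by linarith
    from fq[OF this nz[OF that]] show ?thesis
      by (simp only: norm_mult prod_norm[symmetric] norm_power_int norm_exp_eq_Re)
  qed
  have bl: "norm (blaschke R a (u\<^sup>2)) powi zorder f a
      \<le> norm (blaschke R a (v\<^sup>2)) powi zorder f a * exp (multip a * E a)" if a: "a \<in> zeros R" for a
  proof (rule power_int_ratio_le_exp)
    have aR: "norm a < R" and fa: "f a = 0" using a by (auto simp: zeros_def)
    have "u\<^sup>2 \<noteq> a" "v\<^sup>2 \<noteq> a" using fu fv fa by auto
    moreover have "norm (u\<^sup>2) \<le> R" "norm (v\<^sup>2) \<le> R" using x y R by linarith+
    ultimately show "norm (blaschke R a (u\<^sup>2)) > 0" "norm (blaschke R a (v\<^sup>2)) > 0"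
      using blaschke_nonzero[OF aR] by (simp_all only: zero_less_norm_iff)
    show "norm (blaschke R a (u\<^sup>2)) \<le> norm (blaschke R a (v\<^sup>2)) * exp (E a)"
      unfolding E_def using avoid[OF a] by (intro norm_blaschke_ratio_le_exp R aR x y d r) auto
    \<comment> \<open>Exchanging u and v gives the reversed estimate, needed for negative
      orders.\<close>
    have "norm (v - u) \<le> d" using d by (simp add: norm_minus_commute)
    hence "norm (blaschke R a (v\<^sup>2)) \<le> norm (blaschke R a (u\<^sup>2)) * exp (2 * norm (v\<^sup>2 - u\<^sup>2) / R
          + d * (1 / \<bar>r - Re (csqrt a)\<bar> + 1 / \<bar>r + Re (csqrt a)\<bar>))"
      using avoid[OF a] by (intro norm_blaschke_ratio_le_exp R aR x y r) auto
    thus "norm (blaschke R a (v\<^sup>2)) \<le> norm (blaschke R a (u\<^sup>2)) * exp (E a)"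
      unfolding E_def by (simp only: norm_minus_commute)
  qed
  have P: "(\<Prod>a\<in>zeros R. norm (blaschke R a (u\<^sup>2)) powi zorder f a)
      \<le> (\<Prod>a\<in>zeros R. norm (blaschke R a (v\<^sup>2)) powi zorder f a) * exp (\<Sum>a\<in>zeros R. multip a * E a)"
    unfolding exp_sum[OF finite_zeros] prod.distrib[symmetric]
    by (intro prod_mono) (use bl in auto)
  have "Re (q (u\<^sup>2)) \<le> Re (q (v\<^sup>2)) + 8 / R * mean_abs_ln R * norm (u\<^sup>2 - v\<^sup>2)"
    using qd abs_Re_le_cmod[of "q (u\<^sup>2) - q (v\<^sup>2)"] by simp
  hence Q: "exp (Re (q (u\<^sup>2))) \<le> exp (Re (q (v\<^sup>2))) * exp (8 / R * mean_abs_ln R * norm (u\<^sup>2 - v\<^sup>2))"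
    by (simp only: exp_add[symmetric] exp_le_cancel_iff)
  have "norm (f (u\<^sup>2)) \<le> (exp (Re (q (v\<^sup>2))) * exp (8 / R * mean_abs_ln R * norm (u\<^sup>2 - v\<^sup>2))) *
      ((\<Prod>a\<in>zeros R. norm (blaschke R a (v\<^sup>2)) powi zorder f a) * exp (\<Sum>a\<in>zeros R. multip a * E a))"
    unfolding form[OF x r(1)] by (intro mult_mono P Q) (auto intro!: prod_nonneg)
  also have "\<dots> = norm (f (v\<^sup>2)) * exp (8 / R * mean_abs_ln R * norm (u\<^sup>2 - v\<^sup>2) + (\<Sum>a\<in>zeros R. multip a * E a))"
    unfolding form[OF y r(2)] exp_add by simp
  finally show "norm (f (u\<^sup>2)) \<le> norm (f (v\<^sup>2)) * exp (8 / R * mean_abs_ln R * norm (u\<^sup>2 - v\<^sup>2)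
      + (\<Sum>a\<in>zeros R. multip a * (2 * norm (u\<^sup>2 - v\<^sup>2) / R
          + d * (1 / \<bar>r - Re (csqrt a)\<bar> + 1 / \<bar>r + Re (csqrt a)\<bar>))))" by (simp only: E_def)
qed

end

subsection \<open>Points far from a given finite set\<close>

text \<open>For c >= 1 the terms are compared with 1 / (k + 1). Otherwise the first term is 0, and
  dropping it replaces c by c + 1.\<close>

lemma sum_inverse_right_le_harm:
  fixes c :: real
  shows "(\<Sum>k<M. if c + real k \<ge> 1 then 1 / (c + real k) else 0) \<le> harm M"
proof (induction M arbitrary: c)
  case 0
  show ?case by (simp add: harm_nonneg)
next
  case (Suc M)
  show ?case
  proof (cases "c \<ge> 1")
    case True
    have "(\<Sum>k<Suc M. if c + real k \<ge> 1 then 1 / (c + real k) else 0) \<le> (\<Sum>k<Suc M. inverse (real (Suc k)))"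
      using True by (intro sum_mono) (auto simp: field_simps)
    also have "\<dots> = harm (Suc M)"
      by (simp add: harm_altdef)
    finally show ?thesis .
  next
    case False
    have "(\<Sum>k<Suc M. if c + real k \<ge> 1 then 1 / (c + real k) else 0)
        = (\<Sum>k<M. if (c + 1) + real k \<ge> 1 then 1 / ((c + 1) + real k) else 0)"
    proof -
      have "c + real (Suc k) = (c + 1) + real k" for k by simp
      thus ?thesis unfolding sum.lessThan_Suc_shift using False by (simp only: of_nat_0 add_0_right if_False add_0_left)
    qed
    also have "\<dots> \<le> harm M" by (rule Suc.IH)
    also have "\<dots> \<le> harm (Suc M)" by (simp add: harm_Suc)
    finally show ?thesis .
  qed
qed

text \<open>The terms with c + k >= 1 and those with c + k <= -1 are each bounded by one harmonic
  sum.\<close>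

lemma sum_inverse_dist_le_harm:
  fixes c :: real
  shows "(\<Sum>k<M. if \<bar>c + real k\<bar> \<ge> 1 then 1 / \<bar>c + real k\<bar> else 0) \<le> 2 * harm M"
proof -
  \<comment> \<open>Chosen so that reversing the summation, k to M - 1 - k, turns c + k into - (c' +
    k).\<close>
  define c' where "c' = - c - real M + 1"
  have "(\<Sum>k<M. if c + real k \<le> -1 then 1 / - (c + real k) else 0)
      = (\<Sum>k<M. if c + real (M - Suc k) \<le> -1 then 1 / - (c + real (M - Suc k)) else 0)"
    by (rule sum.nat_diff_reindex[symmetric])
  also have "\<dots> = (\<Sum>k<M. if c' + real k \<ge> 1 then 1 / (c' + real k) else 0)"
  proof (intro sum.cong refl)
    fix k assume "k \<in> {..<M}"
    hence e: "c + real (M - Suc k) = - (c' + real k)" by (simp add: c'_def of_nat_diff)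
    show "(if c + real (M - Suc k) \<le> -1 then 1 / - (c + real (M - Suc k)) else 0)
        = (if c' + real k \<ge> 1 then 1 / (c' + real k) else 0)"
      unfolding e by (simp only: neg_le_iff_le minus_minus)
  qed
  also have "\<dots> \<le> harm M" by (rule sum_inverse_right_le_harm)
  finally have L: "(\<Sum>k<M. if c + real k \<le> -1 then 1 / - (c + real k) else 0) \<le> harm M" .
  have "(\<Sum>k<M. if \<bar>c + real k\<bar> \<ge> 1 then 1 / \<bar>c + real k\<bar> else 0)
      = (\<Sum>k<M. (if c + real k \<ge> 1 then 1 / (c + real k) else 0) + (if c + real k \<le> -1 then 1 / - (c + real k) else 0))"
    by (intro sum.cong) auto
  also have "\<dots> \<le> harm M + harm M"
    unfolding sum.distrib by (intro add_mono L sum_inverse_right_le_harm)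
  finally show ?thesis by simp
qed

text \<open>An open interval of length 2 contains at most two integers.\<close>

lemma card_near_le_2:
  fixes c :: real
  shows "card {k. k < M \<and> \<bar>c + real k\<bar> < 1} \<le> 2"
proof -
  have "{k. k < M \<and> \<bar>c + real k\<bar> < 1} \<subseteq> {nat \<lfloor>- c\<rfloor>, nat (\<lfloor>- c\<rfloor> + 1)}"
  proof
    fix k assume "k \<in> {k. k < M \<and> \<bar>c + real k\<bar> < 1}"
    hence "\<bar>c + real k\<bar> < 1" by simp
    hence "int k = \<lfloor>- c\<rfloor> \<or> int k = \<lfloor>- c\<rfloor> + 1" by linarith
    thus "k \<in> {nat \<lfloor>- c\<rfloor>, nat (\<lfloor>- c\<rfloor> + 1)}" by auto
  qed
  hence "card {k. k < M \<and> \<bar>c + real k\<bar> < 1} \<le> card {nat \<lfloor>- c\<rfloor>, nat (\<lfloor>- c\<rfloor> + 1)}"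
    by (intro card_mono) auto
  also have "\<dots> \<le> 2" by (simp add: card_insert_if)
  finally show ?thesis .
qed

text \<open>
  Averaging over the points \<open>T, T + 1, \<dots>, T + M - 1\<close>: each \<open>p i\<close> spoils at most two of them,
  and contributes a harmonic sum over the remaining ones.
\<close>

lemma exists_far_point:
  fixes p w :: "'i \<Rightarrow> real"
  assumes fin: "finite I" and w: "\<And>i. i \<in> I \<Longrightarrow> w i \<ge> 1" and M: "M > 0"
    and W: "4 * sum w I \<le> M"
  obtains k where "k < M" "\<And>i. i \<in> I \<Longrightarrow> \<bar>T + real k - p i\<bar> \<ge> 1"
    "(\<Sum>i\<in>I. w i / \<bar>T + real k - p i\<bar>) \<le> 4 * sum w I * harm M / M"
proof -
  define bad where "bad = (\<Union>i\<in>I. {k. k < M \<and> \<bar>(T - p i) + real k\<bar> < 1})"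
  define G where "G = {..<M} - bad"
  \<comment> \<open>As all weights are at least 1, \<open>I\<close> has at most M/4 elements, so at
    most M/2 points are spoiled.\<close>
  have "real (card I) \<le> sum w I" using sum_mono[of I "\<lambda>_. 1" w] w by simp
  moreover have "card bad \<le> (\<Sum>i\<in>I. card {k. k < M \<and> \<bar>(T - p i) + real k\<bar> < 1})"
    unfolding bad_def by (rule card_UN_le[OF fin])
  moreover have "\<dots> \<le> (\<Sum>i\<in>I. 2)" by (intro sum_mono card_near_le_2)
  ultimately have cb: "2 * real (card bad) \<le> M" using W by simp
  have "bad \<subseteq> {..<M}" by (auto simp: bad_def)
  hence "card G = M - card bad" unfolding G_def by (subst card_Diff_subset) (auto intro: finite_subset)
  hence cG: "real M / 2 \<le> real (card G)" using cb by linarith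
  have Gne: "G \<noteq> {}" using cG M by auto
  have finG: "finite G" by (simp add: G_def)
  have far: "\<bar>(T - p i) + real k\<bar> \<ge> 1" if "k \<in> G" "i \<in> I" for i k
    using that by (force simp: G_def bad_def)
  define S where "S = (\<lambda>k. \<Sum>i\<in>I. w i / \<bar>T + real k - p i\<bar>)"
  have "(\<Sum>k\<in>G. S k) = (\<Sum>i\<in>I. w i * (\<Sum>k\<in>G. 1 / \<bar>(T - p i) + real k\<bar>))"
    unfolding S_def by (subst sum.swap) (simp add: sum_distrib_left algebra_simps)
  also have "\<dots> \<le> (\<Sum>i\<in>I. w i * (2 * harm M))"
  proof (intro sum_mono mult_left_mono)
    fix i assume i: "i \<in> I"
    have "(\<Sum>k\<in>G. 1 / \<bar>(T - p i) + real k\<bar>)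
        = (\<Sum>k\<in>G. if \<bar>(T - p i) + real k\<bar> \<ge> 1 then 1 / \<bar>(T - p i) + real k\<bar> else 0)"
      using far i by (intro sum.cong) auto
    also have "\<dots> \<le> (\<Sum>k<M. if \<bar>(T - p i) + real k\<bar> \<ge> 1 then 1 / \<bar>(T - p i) + real k\<bar> else 0)"
      by (intro sum_mono2) (auto simp: G_def)
    also have "\<dots> \<le> 2 * harm M" by (rule sum_inverse_dist_le_harm)
    finally show "(\<Sum>k\<in>G. 1 / \<bar>(T - p i) + real k\<bar>) \<le> 2 * harm M" .
    show "0 \<le> w i" using w[OF i] by simp
  qed
  finally have tot: "(\<Sum>k\<in>G. S k) \<le> 2 * sum w I * harm M" by (simp add: sum_distrib_left sum_distrib_right mult_ac)
  \<comment> \<open>The bound for the total over \<open>G\<close>, divided by M/2, which is a lower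
    bound for the size of \<open>G\<close>. Some point of \<open>G\<close> does not exceed this
    average.\<close>
  define B where "B = 4 * sum w I * harm M / M"
  have "B \<ge> 0" unfolding B_def using w by (intro divide_nonneg_nonneg mult_nonneg_nonneg sum_nonneg harm_nonneg) (auto intro: order_trans[OF zero_le_one])
  have "\<exists>k\<in>G. S k \<le> B"
  proof (rule ccontr)
    assume "\<not> (\<exists>k\<in>G. S k \<le> B)"
    hence "(\<Sum>k\<in>G. B) < (\<Sum>k\<in>G. S k)" using finG Gne by (intro sum_strict_mono) auto
    moreover have "real M / 2 * B \<le> real (card G) * B" using cG \<open>B \<ge> 0\<close> by (intro mult_right_mono) auto
    moreover have "real M / 2 * B = 2 * sum w I * harm M" using M by (simp add: B_def)
    ultimately show False using tot by simp
  qed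
  then obtain k where k: "k \<in> G" "S k \<le> B" by blast
  show ?thesis
  proof (rule that[of k])
    show "k < M" using k by (simp add: G_def)
    show "\<bar>T + real k - p i\<bar> \<ge> 1" if "i \<in> I" for i using far[OF k(1) that] by (simp add: algebra_simps)
    show "(\<Sum>i\<in>I. w i / \<bar>T + real k - p i\<bar>) \<le> 4 * sum w I * harm M / M" using k(2) by (simp add: S_def B_def)
  qed
qed

text \<open>The doubled index set carries both p i and - p i; the total weight doubles, and with it
  the constant 4.\<close>

lemma exists_far_point_symmetric:
  fixes p w :: "'i \<Rightarrow> real"
  assumes fin: "finite I" and w: "\<And>i. i \<in> I \<Longrightarrow> w i \<ge> 1" and M: "M > 0"
    and W: "8 * sum w I \<le> M"
  obtains k where "k < M" "\<And>i. i \<in> I \<Longrightarrow> T + real k \<noteq> p i \<and> T + real k \<noteq> - p i"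
    "(\<Sum>i\<in>I. w i * (1 / \<bar>T + real k - p i\<bar> + 1 / \<bar>T + real k + p i\<bar>)) \<le> 8 * sum w I * harm M / M"
proof -
  define p' where "p' = (\<lambda>(i, b). if b then p i else - p i)"
  define w' where "w' = (\<lambda>(i, b::bool). w i)"
  have sw: "sum w' (I \<times> UNIV) = 2 * sum w I"
    by (simp add: w'_def sum.cartesian_product[symmetric] UNIV_bool sum_distrib_left)
  obtain k where k: "k < M" "\<And>j. j \<in> I \<times> UNIV \<Longrightarrow> \<bar>T + real k - p' j\<bar> \<ge> 1"
    "(\<Sum>j\<in>I \<times> UNIV. w' j / \<bar>T + real k - p' j\<bar>) \<le> 4 * sum w' (I \<times> UNIV) * harm M / M"
    by (rule exists_far_point[of "I \<times> (UNIV::bool set)" w' M T p'])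
      (use fin w M W sw in \<open>auto simp: w'_def\<close>)
  show ?thesis
  proof (rule that[OF k(1)])
    fix i assume i: "i \<in> I"
    show "T + real k \<noteq> p i \<and> T + real k \<noteq> - p i"
      using k(2)[of "(i, True)"] k(2)[of "(i, False)"] i by (auto simp: p'_def)
  next
    have "(\<Sum>j\<in>I \<times> UNIV. w' j / \<bar>T + real k - p' j\<bar>)
        = (\<Sum>i\<in>I. \<Sum>b\<in>UNIV. w' (i, b) / \<bar>T + real k - p' (i, b)\<bar>)"
      by (simp add: sum.cartesian_product case_prod_unfold)
    also have "\<dots> = (\<Sum>i\<in>I. w i * (1 / \<bar>T + real k - p i\<bar> + 1 / \<bar>T + real k + p i\<bar>))"
      by (intro sum.cong refl) (simp add: UNIV_bool w'_def p'_def algebra_simps)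
    finally show "(\<Sum>i\<in>I. w i * (1 / \<bar>T + real k - p i\<bar> + 1 / \<bar>T + real k + p i\<bar>)) \<le> 8 * sum w I * harm M / M"
      using k(3) sw by simp
  qed
qed

subsection \<open>Consequences of small growth\<close>

context nonzero_meromorphic
begin

text \<open>The value 0 signals a zero or a pole, and neither has order 0. This is the weight
  condition of \<open>exists_far_point_symmetric\<close>.\<close>

lemma multip_ge_1:
  assumes "f a = 0"
  shows "multip a \<ge> 1"
proof (cases "is_pole f a")
  case True
  then show ?thesis using is_pole_iff by simp
next
  case False
  hence "f analytic_on {a}" using nicely_meromorphic_on_imp_analytic_at[OF mero] by simp
  hence "zorder f a > 0" using zorder_pos_iff'[OF _ frequently_nonzero] assms by blast
  then show ?thesis by linarith
qed

text \<open>A common majorant for the mean and for the number of zeros and poles when T(r, f) <=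
  r^\<beta>. The argument 4 * R leaves room for the larger circle used in counting.\<close>

definition growth_bound :: "real \<Rightarrow> real \<Rightarrow> real" where
  "growth_bound \<beta> R = 2 * (4 * R) powr \<beta>
     + (\<bar>ln (norm (zor_poly f 0 0))\<bar> + multip 0 * ln (4 * R) + multip 0)"

text \<open>The assumption of order below 1/2 enters here. The factor 1 + ln R pays for the harmonic
  sum in the averaging argument.\<close>

lemma growth_bound_negligible:
  assumes "0 < \<beta>" "\<beta> < 1 / 2"
  shows "((\<lambda>R. growth_bound \<beta> R * (1 + ln R) / sqrt R) \<longlongrightarrow> 0) at_top"
proof -
  have 1: "((\<lambda>R. (2 * (4 * R) powr \<beta>) * (1 + ln R) / sqrt R) \<longlongrightarrow> 0) at_top"
    using assms by real_asymp
  have 2: "((\<lambda>R. (c + k * ln (4 * R) + k) * (1 + ln R) / sqrt R) \<longlongrightarrow> 0) at_top" for c k :: real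
    by real_asymp
  show ?thesis
    using tendsto_add[OF 1 2[of "\<bar>ln (norm (zor_poly f 0 0))\<bar>" "multip 0"]]
    by (simp add: growth_bound_def distrib_right add_divide_distrib)
qed

text \<open>The mean is read off on the circle of radius R itself; the multiplicities need a circle
  free of zeros and poles, of radius S between 3R and 3R + 1 <= 4R.\<close>

lemma growth_bounds:
  assumes T: "\<And>r. r \<ge> R0 \<Longrightarrow> nevanlinna_char f r \<le> r powr \<beta>" and \<beta>: "\<beta> > 0"
    and R: "R \<ge> 1" "R \<ge> R0" and circ: "\<And>x. norm x = R \<Longrightarrow> f x \<noteq> 0"
  shows "mean_abs_ln R \<le> growth_bound \<beta> R" "(\<Sum>a\<in>zeros R. multip a) \<le> growth_bound \<beta> R"
proof -
  have le: "2 * nevanlinna_char f S + \<bar>ln (norm (zor_poly f 0 0))\<bar> + multip 0 * ln S + multip 0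
      \<le> growth_bound \<beta> R" if S: "R \<le> S" "S \<le> 4 * R" for S
  proof -
    have "nevanlinna_char f S \<le> S powr \<beta>" using T S R by auto
    also have "\<dots> \<le> (4 * R) powr \<beta>" using S R \<beta> by (intro powr_mono2) auto
    finally have "nevanlinna_char f S \<le> (4 * R) powr \<beta>" .
    moreover have "multip 0 * ln S \<le> multip 0 * ln (4 * R)"
      using S R by (intro mult_left_mono) auto
    ultimately show ?thesis by (simp add: growth_bound_def)
  qed
  show "mean_abs_ln R \<le> growth_bound \<beta> R"
    using nevanlinna_bounds(1)[OF R(1) circ] le[of R] R abs_ge_zero[of "real_of_int (zorder f 0)"]
    by linarith
  obtain S where S: "S > 3 * R" "S < 3 * R + 1" "\<And>x. norm x = S \<Longrightarrow> f x \<noteq> 0"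
    using generic_radius by blast
  have "(\<Sum>a\<in>zeros R. multip a)
    \<le> 2 * nevanlinna_char f S + \<bar>ln (norm (zor_poly f 0 0))\<bar> + multip 0 * ln S + multip 0"
    using S R by (intro sum_multip_le) auto
  also have "\<dots> \<le> growth_bound \<beta> R" using S R by (intro le) auto
  finally show "(\<Sum>a\<in>zeros R. multip a) \<le> growth_bound \<beta> R" .
qed

text \<open>The core estimate, for arbitrarily large t. Both signs of \<open>r\<close> are covered
  because the square root may lie in either half-plane.\<close>

lemma comparable_values:
  assumes T: "\<And>r. r \<ge> R0 \<Longrightarrow> nevanlinna_char f r \<le> r powr \<beta>" and \<beta>: "0 < \<beta>" "\<beta> < 1 / 2"
    and d: "d \<ge> 0"
  shows "\<exists>t\<ge>t0. \<forall>u v r. \<bar>r\<bar> = t \<longrightarrow> Re u = r \<longrightarrow> Re v = r \<longrightarrow> \<bar>Im u\<bar> \<le> d \<longrightarrow> \<bar>Im v\<bar> \<le> d \<longrightarrow> norm (u - v) \<le> d \<longrightarrow>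
    f (u\<^sup>2) \<noteq> 0 \<and> f (v\<^sup>2) \<noteq> 0 \<and> norm (f (u\<^sup>2)) \<le> norm (f (v\<^sup>2)) * exp 1"
proof -
  \<comment> \<open>The errors will be 8 \<epsilon> d from \<open>q\<close> and 82 \<epsilon> d from
    the Blaschke factors, together at most 1.\<close>
  define \<epsilon> where "\<epsilon> = 1 / (90 * (1 + d))"
  have \<epsilon>: "\<epsilon> > 0" using d by (simp add: \<epsilon>_def)
  have "eventually (\<lambda>R. growth_bound \<beta> R * (1 + ln R) / sqrt R < \<epsilon>) at_top"
    using growth_bound_negligible[OF \<beta>] \<epsilon> by (rule order_tendstoD(2))
  \<comment> \<open>With Q = sqrt R these bounds give Q >= 10, Q/5 >= t0 and d <= Q/10.\<close>
  moreover have "eventually (\<lambda>R. R \<ge> Max {100, R0, (5 * t0)\<^sup>2, (10 * d)\<^sup>2}) at_top"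
    by (rule eventually_ge_at_top)
  ultimately have "eventually (\<lambda>R. growth_bound \<beta> R * (1 + ln R) / sqrt R < \<epsilon> \<and> R \<ge> 100 \<and> R \<ge> R0 \<and>
      R \<ge> (5 * t0)\<^sup>2 \<and> R \<ge> (10 * d)\<^sup>2) at_top"
    by eventually_elim simp
  then obtain S where S: "\<And>R. R \<ge> S \<Longrightarrow> growth_bound \<beta> R * (1 + ln R) / sqrt R < \<epsilon> \<and> R \<ge> 100 \<and> R \<ge> R0 \<and>
      R \<ge> (5 * t0)\<^sup>2 \<and> R \<ge> (10 * d)\<^sup>2"
    by (auto simp: eventually_at_top_linorder)
  obtain R where "R > S" and circ: "\<And>x. norm x = R \<Longrightarrow> f x \<noteq> 0"
    using generic_radius by blast
  hence R: "growth_bound \<beta> R * (1 + ln R) / sqrt R < \<epsilon>" "R \<ge> 100" "R \<ge> R0" "R \<ge> (5 * t0)\<^sup>2" "R \<ge> (10 * d)\<^sup>2"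
    using S[of R] by auto
  define Q where "Q = sqrt R"
  have Q: "Q \<ge> 10" using R(2) real_le_rsqrt[of 10 R] by (simp add: Q_def)
  have QR: "Q * Q = R" using R by (simp add: Q_def)
  have Qt: "5 * t0 \<le> Q" "10 * d \<le> Q" using R by (auto simp: Q_def intro: real_le_rsqrt)
  define W where "W = (\<Sum>a\<in>zeros R. multip a)"
  define D where "D = growth_bound \<beta> R"
  have A: "mean_abs_ln R \<le> D" and WD: "W \<le> D"
    using growth_bounds[OF T \<beta>(1) _ R(3) circ] R(2) by (auto simp: W_def D_def)
  have W0: "W \<ge> 0" by (simp add: W_def sum_nonneg)
  have D0: "D \<ge> 0" using W0 WD by simp
  have lnR: "ln R \<ge> 0" using R(2) by simp
  have De: "D * (1 + ln R) \<le> \<epsilon> * Q"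
    using R(1) Q by (simp add: D_def Q_def[symmetric] field_simps)
  have "D * 1 \<le> D * (1 + ln R)" using D0 lnR by (intro mult_left_mono) auto
  hence De1: "D \<le> \<epsilon> * Q" using De by simp
  \<comment> \<open>The candidates Q/5 + k with k < M lie in [Q/5, 2Q/5); even with imaginary part
    up to d, their squares stay in the half-size disc.\<close>
  define M where "M = nat \<lfloor>Q / 5\<rfloor>"
  have M: "real M \<le> Q / 5" "real M \<ge> Q / 10"
  proof -
    have "real M = of_int \<lfloor>Q / 5\<rfloor>" using Q by (simp add: M_def)
    thus "real M \<le> Q / 5" "real M \<ge> Q / 10" using floor_correct[of "Q / 5"] Q by linarith+
  qed
  have M0: "M > 0" using M(2) Q by (cases M) auto
  have "\<epsilon> * 80 \<le> 1" using d by (simp add: \<epsilon>_def)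
  hence "(\<epsilon> * 80) * Q \<le> 1 * Q" using Q by (intro mult_right_mono) auto
  hence WM: "8 * W \<le> M" using WD De1 M(2) by linarith
  obtain k where k: "k < M"
    "\<And>a. a \<in> zeros R \<Longrightarrow> Q / 5 + real k \<noteq> Re (csqrt a) \<and> Q / 5 + real k \<noteq> - Re (csqrt a)"
    "(\<Sum>a\<in>zeros R. multip a * (1 / \<bar>Q / 5 + real k - Re (csqrt a)\<bar> + 1 / \<bar>Q / 5 + real k + Re (csqrt a)\<bar>))
       \<le> 8 * W * harm M / M"
    using exists_far_point_symmetric[OF finite_zeros _ M0, of R multip "Q / 5" "\<lambda>a. Re (csqrt a)"] WM multip_ge_1
    unfolding W_def zeros_def by blast
  define t where "t = Q / 5 + real k"
  have t: "t \<ge> t0" "0 \<le> t" "t \<le> 2 * Q / 5"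
    using Qt M(1) k(1) Q by (auto simp: t_def)
  have harm: "harm M \<le> 1 + ln R"
  proof -
    \<comment> \<open>The sequence harm M - ln M decreases and equals 1 at M = 1.\<close>
    have "harm M - ln (real M) \<le> harm 1 - ln (real 1)"
      using M0 by (intro euler_mascheroni_sequence_decreasing) auto
    moreover have "ln (real M) \<le> ln R"
    proof -
      have "Q * 1 \<le> Q * Q" using Q by (intro mult_left_mono) auto
      hence "real M \<le> R" using M(1) Q QR by linarith
      thus ?thesis using M0 by simp
    qed
    ultimately show ?thesis by (simp add: harm_expand)
  qed
  have far: "8 * W * harm M / M \<le> 80 * \<epsilon>"
  proof -
    have "W * harm M \<le> D * (1 + ln R)" using WD W0 harm lnR by (intro mult_mono) (auto simp: harm_nonneg)
    hence "8 * W * harm M \<le> 8 * (\<epsilon> * Q)" using De by linarith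
    also have "\<dots> = 80 * \<epsilon> * (Q / 10)" by simp
    also have "\<dots> \<le> 80 * \<epsilon> * M" using M(2) \<epsilon> by (intro mult_left_mono) auto
    finally show ?thesis using M0 by (simp add: field_simps)
  qed
  show ?thesis
  proof (intro exI[of _ t] conjI t(1) allI impI)
    fix u v r assume r: "\<bar>r\<bar> = t" "Re u = r" "Re v = r" and I: "\<bar>Im u\<bar> \<le> d" "\<bar>Im v\<bar> \<le> d"
      and uv: "norm (u - v) \<le> d"
    have small: "norm w \<le> Q / 2" "norm (w\<^sup>2) \<le> R / 2" if "Re w = r" "\<bar>Im w\<bar> \<le> d" for w
    proof -
      have "norm w \<le> \<bar>Re w\<bar> + \<bar>Im w\<bar>" by (rule cmod_le)
      thus *: "norm w \<le> Q / 2" using that r t(3) Qt by linarith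
      have "norm w * norm w \<le> (Q / 2) * (Q / 2)" using * Q by (intro mult_mono) auto
      thus "norm (w\<^sup>2) \<le> R / 2" using QR R(2) by (simp only: norm_mult power2_eq_square)
    qed
    \<comment> \<open>The squares differ by O(sqrt R) only, a factor Q less than the scale R on
      which \<open>q\<close> varies.\<close>
    have sq: "norm (u\<^sup>2 - v\<^sup>2) \<le> d * Q"
    proof -
      have "norm (u\<^sup>2 - v\<^sup>2) = norm (u - v) * norm (u + v)"
        by (simp add: norm_mult[symmetric] power2_eq_square algebra_simps)
      also have "\<dots> \<le> d * Q"
        using uv d norm_triangle_ineq[of u v] small(1)[OF r(2) I(1)] small(1)[OF r(3) I(2)]
        by (intro mult_mono) auto
      finally show ?thesis .
    qed
    have rr: "r = t \<or> r = - t" using r(1) t(2) by linarith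
    have avoid: "r \<noteq> Re (csqrt a) \<and> r \<noteq> - Re (csqrt a)" if "a \<in> zeros R" for a
      using k(2)[OF that] rr unfolding t_def[symmetric] by linarith
    have R0': "R > 0" using R(2) by simp
    note main = norm_ratio_le_exp[OF R0' circ small(2)[OF r(2) I(1)] small(2)[OF r(3) I(2)] uv r(2,3) avoid]
    define e where "e = norm (u\<^sup>2 - v\<^sup>2)"
    have eR: "e / R \<le> d / Q"
    proof -
      have "e / R \<le> d * Q / R" using sq R0' unfolding e_def by (intro divide_right_mono) auto
      also have "\<dots> = d / Q" using Q unfolding QR[symmetric] by simp
      finally show ?thesis .
    qed
    have DQ: "D * (d / Q) \<le> \<epsilon> * d"
    proof -
      have "D * (d / Q) \<le> (\<epsilon> * Q) * (d / Q)" using De1 d Q by (intro mult_right_mono) auto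
      thus ?thesis using Q by simp
    qed
    have e0: "e / R \<ge> 0" using R0' by (simp add: e_def)
    have E1: "8 / R * mean_abs_ln R * e \<le> 8 * (\<epsilon> * d)"
    proof -
      have "mean_abs_ln R * (e / R) \<le> D * (e / R)" using A e0 by (intro mult_right_mono) auto
      also have "\<dots> \<le> D * (d / Q)" using eR D0 by (intro mult_left_mono) auto
      also have "\<dots> \<le> \<epsilon> * d" by (rule DQ)
      finally have "mean_abs_ln R * (e / R) \<le> \<epsilon> * d" .
      moreover have "8 / R * mean_abs_ln R * e = 8 * (mean_abs_ln R * (e / R))" by simp
      ultimately show ?thesis by linarith
    qed
    define F where "F = (\<lambda>a. 1 / \<bar>r - Re (csqrt a)\<bar> + 1 / \<bar>r + Re (csqrt a)\<bar>)"
    \<comment> \<open>Changing the sign of t only swaps the two fractions, so one choice of t serves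
      both signs of r.\<close>
    have Ft: "F a = 1 / \<bar>t - Re (csqrt a)\<bar> + 1 / \<bar>t + Re (csqrt a)\<bar>" for a
    proof -
      have "\<bar>- t - Re (csqrt a)\<bar> = \<bar>t + Re (csqrt a)\<bar>" "\<bar>- t + Re (csqrt a)\<bar> = \<bar>t - Re (csqrt a)\<bar>"
        by linarith+
      thus ?thesis using rr unfolding F_def by (elim disjE) (simp_all only: add.commute)
    qed
    have "(\<Sum>a\<in>zeros R. multip a * (2 * e / R + d * F a))
        = W * (2 * (e / R)) + d * (\<Sum>a\<in>zeros R. multip a * F a)"
      by (simp add: W_def sum_distrib_left sum_distrib_right distrib_left sum.distrib mult_ac)
    \<comment> \<open>The first summand comes from the Blaschke denominators, the second from the
      distance to the zeros and poles.\<close>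
    also have "\<dots> \<le> 2 * (\<epsilon> * d) + d * (80 * \<epsilon>)"
    proof (intro add_mono mult_left_mono d)
      have "W * (e / R) \<le> D * (d / Q)" using WD eR D0 e0 by (intro mult_mono) auto
      hence "2 * (W * (e / R)) \<le> 2 * (\<epsilon> * d)" using DQ by linarith
      thus "W * (2 * (e / R)) \<le> 2 * (\<epsilon> * d)" by (simp only: mult.left_commute)
      show "(\<Sum>a\<in>zeros R. multip a * F a) \<le> 80 * \<epsilon>"
        using k(3) far unfolding Ft t_def by linarith
    qed
    finally have E2: "(\<Sum>a\<in>zeros R. multip a * (2 * e / R + d * F a)) \<le> 82 * (\<epsilon> * d)" by simp
    have \<epsilon>d: "90 * (\<epsilon> * d) \<le> 1" using d by (simp add: \<epsilon>_def field_simps)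
    show "f (u\<^sup>2) \<noteq> 0" "f (v\<^sup>2) \<noteq> 0" using main(1,2) by blast+
    have "norm (f (u\<^sup>2)) \<le> norm (f (v\<^sup>2)) * exp (8 / R * mean_abs_ln R * e
        + (\<Sum>a\<in>zeros R. multip a * (2 * e / R + d * F a)))"
      using main(3) by (simp only: e_def F_def)
    also have "\<dots> \<le> norm (f (v\<^sup>2)) * exp 1"
    proof -
      have "8 / R * mean_abs_ln R * e + (\<Sum>a\<in>zeros R. multip a * (2 * e / R + d * F a)) \<le> 1"
        using E1 E2 \<epsilon>d by linarith
      thus ?thesis by (intro mult_left_mono) auto
    qed
    finally show "norm (f (u\<^sup>2)) \<le> norm (f (v\<^sup>2)) * exp 1" .
  qed
qed

end

subsection \<open>The difference equation\<close>

text \<open>For x > 0 the root is real and nonzero. Adding i/2 keeps its real part, so at each step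
  the branch recovers the point that was squared, and the shifts accumulate linearly.\<close>

lemma wilson_shift_eq:
  assumes s: "wilson_sqrt s" and x: "x > 0"
  shows "\<bar>Re (s (of_real x))\<bar> = sqrt x" "Im (s (of_real x)) = 0"
    "wilson_shift s m (of_real x) = (s (of_real x) + of_nat m * \<i> / 2)\<^sup>2"
proof -
  \<comment> \<open>The sign of the half-plane of values, which treats both branches at
    once.\<close>
  obtain \<sigma> :: real where \<sigma>: "\<sigma> = 1 \<or> \<sigma> = -1" and pos: "\<And>x. x \<notin> \<real>\<^sub>\<le>\<^sub>0 \<Longrightarrow> \<sigma> * Re (s x) > 0"
    and sq: "\<And>x. (s x)\<^sup>2 = x"
    using s unfolding wilson_sqrt_def by (metis mult_1 mult_minus1 neg_0_less_iff_less)
  \<comment> \<open>Of the two roots w and -w only w lies in the half-plane of the branch.\<close>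
  have inv: "s (w\<^sup>2) = w" if w: "\<sigma> * Re w > 0" for w
  proof -
    have "w\<^sup>2 \<notin> \<real>\<^sub>\<le>\<^sub>0"
    proof
      assume "w\<^sup>2 \<in> \<real>\<^sub>\<le>\<^sub>0"
      hence "Re (w\<^sup>2) \<le> 0" "Im (w\<^sup>2) = 0" by (auto simp: complex_nonpos_Reals_iff)
      moreover have "Re w \<noteq> 0" using w by auto
      ultimately have "Re w * Re w \<le> 0" by (auto simp: power2_eq_square)
      moreover have "Re w * Re w > 0" using \<open>Re w \<noteq> 0\<close> by (auto simp: zero_less_mult_iff)
      ultimately show False by linarith
    qed
    hence "\<sigma> * Re (s (w\<^sup>2)) > 0" by (rule pos)
    moreover have "s (w\<^sup>2) = w \<or> s (w\<^sup>2) = - w" using sq[of "w\<^sup>2"] by (simp add: power2_eq_iff)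
    ultimately show ?thesis using w by auto
  qed
  define z where "z = complex_of_real (\<sigma> * sqrt x)"
  have z2: "z\<^sup>2 = of_real x"
  proof -
    have "(\<sigma> * sqrt x)\<^sup>2 = x" using \<sigma> x by (auto simp: power_mult_distrib)
    thus ?thesis unfolding z_def of_real_power[symmetric] by simp
  qed
  have zpos: "\<sigma> * Re z > 0" using \<sigma> x by (auto simp: z_def)
  have sz: "s (of_real x) = z" using inv[OF zpos] z2 by simp
  show "\<bar>Re (s (of_real x))\<bar> = sqrt x" "Im (s (of_real x)) = 0"
    using \<sigma> x unfolding sz by (auto simp: z_def)
  show "wilson_shift s m (of_real x) = (s (of_real x) + of_nat m * \<i> / 2)\<^sup>2"
  proof (induction m)
    case 0
    show ?case using z2 by (simp add: wilson_shift_def sz)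
  next
    case (Suc m)
    have "\<sigma> * Re (z + of_nat m * \<i> / 2) > 0" using zpos by simp
    from inv[OF this] Suc have "s (wilson_shift s m (of_real x)) = z + of_nat m * \<i> / 2"
      by (simp add: sz)
    hence "wilson_shift s (Suc m) (of_real x) = (z + of_nat m * \<i> / 2 + \<i> / 2)\<^sup>2"
      by (simp add: wilson_shift_def wilson_plus_def)
    also have "z + of_nat m * \<i> / 2 + \<i> / 2 = z + of_nat (Suc m) * \<i> / 2"
      by (simp add: field_simps)
    finally show ?case by (simp only: sz)
  qed
qed

text \<open>Each quotient p k / q tends to 0 at infinity, and beyond the finitely many roots of q
  the denominator can be cleared.\<close>

lemma eventually_poly_dominates:
  fixes p :: "'i \<Rightarrow> complex poly"
  assumes fin: "finite I" and q: "q \<noteq> 0" and less: "\<And>k. k \<in> I \<Longrightarrow> p k = 0 \<or> degree (p k) < degree q"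
  shows "eventually (\<lambda>x. C * (\<Sum>k\<in>I. norm (poly (p k) x)) < norm (poly q x)) at_infinity"
proof -
  have "((\<lambda>x. C * (\<Sum>k\<in>I. norm (poly (p k) x / poly q x))) \<longlongrightarrow> C * (\<Sum>k\<in>I. norm (0::complex))) at_infinity"
  proof (intro tendsto_mult_left tendsto_sum tendsto_norm)
    fix k assume "k \<in> I"
    from less[OF this] show "((\<lambda>x. poly (p k) x / poly q x) \<longlongrightarrow> 0) at_infinity"
      by (auto intro: poly_divide_tendsto_0_at_infinity)
  qed
  hence "((\<lambda>x. C * (\<Sum>k\<in>I. norm (poly (p k) x / poly q x))) \<longlongrightarrow> 0) at_infinity" by simp
  hence "eventually (\<lambda>x. C * (\<Sum>k\<in>I. norm (poly (p k) x / poly q x)) < 1) at_infinity"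
    by (rule order_tendstoD(2)) simp
  moreover have "eventually (\<lambda>x. poly q x \<noteq> 0) at_infinity"
  proof -
    have "bounded {x. poly q x = 0}" using q by (intro finite_imp_bounded poly_roots_finite)
    then obtain B where "\<And>x. poly q x = 0 \<Longrightarrow> norm x \<le> B" by (auto simp: bounded_iff)
    thus ?thesis unfolding eventually_at_infinity by (intro exI[of _ "B + 1"]) force
  qed
  ultimately show ?thesis
  proof eventually_elim
    case (elim x)
    have "C * (\<Sum>k\<in>I. norm (poly (p k) x / poly q x)) = C * (\<Sum>k\<in>I. norm (poly (p k) x)) / norm (poly q x)"
      by (simp only: norm_divide sum_divide_distrib[symmetric] times_divide_eq_right)
    thus ?case using elim by (simp add: pos_divide_less_eq)
  qed
qed

text \<open>An exponent strictly between the order and b turns the upper limit into an eventual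
  power bound.\<close>

lemma nevanlinna_order_lessD:
  assumes "nevanlinna_order f < ereal b" "b > 0"
  obtains \<beta> R0 where "0 < \<beta>" "\<beta> < b" "\<And>r. r \<ge> R0 \<Longrightarrow> nevanlinna_char f r \<le> r powr \<beta>"
proof -
  obtain b' where b': "nevanlinna_order f < ereal b'" "ereal b' < ereal b"
    using ereal_dense2[OF assms(1)] by blast
  \<comment> \<open>The maximum with b / 2 keeps the exponent positive.\<close>
  define \<beta> where "\<beta> = max b' (b / 2)"
  have \<beta>: "0 < \<beta>" "\<beta> < b" using b'(2) assms(2) by (auto simp: \<beta>_def)
  have "nevanlinna_order f < ereal \<beta>"
    using b'(1) by (rule order_less_le_trans) (simp add: \<beta>_def)
  hence "eventually (\<lambda>r. ereal (ln_plus (nevanlinna_char f r) / ln r) < ereal \<beta>) at_top"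
    unfolding nevanlinna_order_def by (rule Limsup_lessD)
  moreover have "eventually (\<lambda>r::real. r > 1) at_top" by (rule eventually_gt_at_top)
  ultimately have "eventually (\<lambda>r. nevanlinna_char f r \<le> r powr \<beta>) at_top"
  proof eventually_elim
    case (elim r)
    show ?case
    proof (cases "nevanlinna_char f r > 0")
      case True
      have "ln_plus (nevanlinna_char f r) < \<beta> * ln r" using elim by (simp add: pos_divide_less_eq)
      hence "ln (nevanlinna_char f r) \<le> ln (r powr \<beta>)" using elim by (simp add: ln_plus_def ln_powr)
      moreover have "r powr \<beta> > 0" using elim by simp
      ultimately show ?thesis using True ln_le_cancel_iff by blast
    next
      case False
      thus ?thesis by (meson linorder_not_less order_trans powr_ge_zero)
    qed
  qed
  thus ?thesis using \<beta> that by (auto simp: eventually_at_top_linorder)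
qed

theorem theorem7p7:
  fixes s :: "complex \<Rightarrow> complex"
    and n l :: nat
    and p :: "nat \<Rightarrow> complex poly"
    and f :: "complex \<Rightarrow> complex"
  assumes "wilson_sqrt s"
    and "n > 0"
    and "l \<le> n"
    and "\<And>k. k \<le> n \<Longrightarrow> k \<noteq> l \<Longrightarrow> edegree (p k) < edegree (p l)"
    and "f nicely_meromorphic_on UNIV"
    and "\<exists>x. f x \<noteq> 0"
    and "wilson_solution s n p f"
  shows "nevanlinna_order f \<ge> 1 / 2"
proof (rule ccontr)
  assume "\<not> nevanlinna_order f \<ge> 1 / 2"
  moreover have "(1 / 2 :: ereal) = ereal (1 / 2)"
    by (simp add: one_ereal_def numeral_eq_ereal)
  ultimately have "nevanlinna_order f < ereal (1 / 2)" by simp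
  then obtain \<beta> R0 where \<beta>: "0 < \<beta>" "\<beta> < 1 / 2" and T: "\<And>r. r \<ge> R0 \<Longrightarrow> nevanlinna_char f r \<le> r powr \<beta>"
    using nevanlinna_order_lessD[of f "1 / 2"] by auto
  interpret nonzero_meromorphic f by unfold_locales fact+
  \<comment> \<open>Since n > 0 there is an index besides l, and no degree lies below that of the
    zero polynomial.\<close>
  have pl: "p l \<noteq> 0"
  proof -
    obtain k where "k \<le> n" "k \<noteq> l" using assms(2) by (cases "l = 0") auto
    hence "edegree (p l) \<noteq> -\<infinity>" using assms(4)[of k] by auto
    thus ?thesis by (auto simp: edegree_def)
  qed
  have less: "p k = 0 \<or> degree (p k) < degree (p l)" if "k \<in> {..n} - {l}" for k
    using assms(4)[of k] that pl by (auto simp: edegree_def split: if_splits)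
  have "eventually (\<lambda>x. exp 1 * (\<Sum>k\<in>{..n} - {l}. norm (poly (p k) x)) < norm (poly (p l) x)) at_infinity"
    by (rule eventually_poly_dominates) (use pl less in auto)
  then obtain r0 where dom: "\<And>x. norm x \<ge> r0 \<Longrightarrow>
      exp 1 * (\<Sum>k\<in>{..n} - {l}. norm (poly (p k) x)) < norm (poly (p l) x)"
    by (auto simp: eventually_at_infinity)
  \<comment> \<open>The width d = n suffices, as the shifts move the root by k i/2 with k <=
    n.\<close>
  have "\<exists>t\<ge>max 1 r0. \<forall>u v r. \<bar>r\<bar> = t \<longrightarrow> Re u = r \<longrightarrow> Re v = r \<longrightarrow>
      \<bar>Im u\<bar> \<le> real n \<longrightarrow> \<bar>Im v\<bar> \<le> real n \<longrightarrow> norm (u - v) \<le> real n \<longrightarrow>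
      f (u\<^sup>2) \<noteq> 0 \<and> f (v\<^sup>2) \<noteq> 0 \<and> norm (f (u\<^sup>2)) \<le> norm (f (v\<^sup>2)) * exp 1"
    using T \<beta> by (rule comparable_values) auto
  then obtain t where t: "t \<ge> max 1 r0" and comp: "\<And>u v r. \<bar>r\<bar> = t \<Longrightarrow> Re u = r \<Longrightarrow> Re v = r \<Longrightarrow>
      \<bar>Im u\<bar> \<le> real n \<Longrightarrow> \<bar>Im v\<bar> \<le> real n \<Longrightarrow> norm (u - v) \<le> real n \<Longrightarrow>
      f (u\<^sup>2) \<noteq> 0 \<and> f (v\<^sup>2) \<noteq> 0 \<and> norm (f (u\<^sup>2)) \<le> norm (f (v\<^sup>2)) * exp 1"
    by blast
  \<comment> \<open>The root of x is t or -t, so all shifts of x are squares of points on one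
    vertical line.\<close>
  define x where "x = complex_of_real (t\<^sup>2)"
  have t2: "t\<^sup>2 > 0" using t by simp
  have "t * 1 \<le> t * t" using t by (intro mult_left_mono) auto
  moreover have "norm x = t * t" by (simp add: x_def norm_mult power2_eq_square)
  ultimately have nx: "norm x \<ge> r0" using t by linarith
  define u where "u = (\<lambda>k::nat. s x + of_nat k * \<i> / 2)"
  note sx = wilson_shift_eq[OF assms(1) t2, folded x_def]
  have sh: "wilson_shift s k x = (u k)\<^sup>2" for k using sx(3) by (simp add: u_def)
  have Reu: "Re (u k) = Re (s x)" and Imu: "Im (u k) = real k / 2" for k
    using sx(2) by (simp_all add: u_def)
  have ru: "\<bar>Re (s x)\<bar> = t" using sx(1) t by simp
  have cmp: "f ((u k)\<^sup>2) \<noteq> 0 \<and> f ((u l)\<^sup>2) \<noteq> 0 \<and> norm (f ((u k)\<^sup>2)) \<le> norm (f ((u l)\<^sup>2)) * exp 1"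
    if k: "k \<le> n" for k
  proof (rule comp[OF ru Reu Reu])
    show "\<bar>Im (u k)\<bar> \<le> real n" "\<bar>Im (u l)\<bar> \<le> real n" using k assms(3) by (auto simp: Imu)
    have "norm (u k - u l) \<le> \<bar>Re (u k - u l)\<bar> + \<bar>Im (u k - u l)\<bar>" by (rule cmod_le)
    also have "\<dots> = \<bar>real k / 2 - real l / 2\<bar>" by (simp add: Reu Imu)
    also have "\<dots> \<le> real n" using k assms(3) by linarith
    finally show "norm (u k - u l) \<le> real n" .
  qed
  \<comment> \<open>Nonzero values of \<open>f\<close> at the shifts rule out poles there, so the
    equation applies at this x.\<close>
  have "(\<Sum>k\<le>n. poly (p k) x * f (wilson_shift s k x)) = 0"
    using assms(7) cmp pole_imp_zero sh unfolding wilson_solution_def by metis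
  hence "(\<Sum>k\<le>n. poly (p k) x * f ((u k)\<^sup>2)) = 0" by (simp add: sh)
  hence "poly (p l) x * f ((u l)\<^sup>2) = - (\<Sum>k\<in>{..n} - {l}. poly (p k) x * f ((u k)\<^sup>2))"
    using assms(3) by (simp add: sum.remove[of "{..n}" l] add_eq_0_iff)
  hence "norm (poly (p l) x) * norm (f ((u l)\<^sup>2)) = norm (\<Sum>k\<in>{..n} - {l}. poly (p k) x * f ((u k)\<^sup>2))"
    by (metis norm_minus_cancel norm_mult)
  also have "\<dots> \<le> (\<Sum>k\<in>{..n} - {l}. norm (poly (p k) x) * norm (f ((u k)\<^sup>2)))"
    by (rule order_trans[OF norm_sum]) (simp add: norm_mult)
  also have "\<dots> \<le> (\<Sum>k\<in>{..n} - {l}. norm (poly (p k) x) * (norm (f ((u l)\<^sup>2)) * exp 1))"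
    using cmp by (intro sum_mono mult_left_mono) auto
  also have "\<dots> = (exp 1 * (\<Sum>k\<in>{..n} - {l}. norm (poly (p k) x))) * norm (f ((u l)\<^sup>2))"
    by (simp add: sum_distrib_left sum_distrib_right mult_ac)
  \<comment> \<open>The common factor |f ((u l)^2)| is nonzero and cancels, against the dominance of
    \<open>p l\<close>.\<close>
  finally have "norm (poly (p l) x) \<le> exp 1 * (\<Sum>k\<in>{..n} - {l}. norm (poly (p k) x))"
    using cmp[OF assms(3)] by (simp add: mult_le_cancel_right)
  thus False using dom[OF nx] by linarith
qed

end
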